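(* Let $n\ge 2$, let $D\subset\mathbb{R}^l$ be compact, and let $a:D\times\mathbb{R}^n\to\mathbb{R}$ be a locally Lipschitz mapping that satisfies, for certain constants $\alpha,\beta>0$, $\alpha\le a(d,x)\le\beta$ for all $(d,x)\in D\times\mathbb{R}^n$. Consider the system $$\dot x_i(t)=x_{i+1}(t)+v_i(t),\quad i=1,\dots,n-1,\qquad \dot x_n(t)=v_n(t)+a(d(t),x(t))\,u(t),\qquad (\mathrm{S})$$ with $x(t)=(x_1(t),\dots,x_n(t))'\in\mathbb{R}^n$, $d(t)\in D$, $v(t)=(v_1(t),\dots,v_n(t))'\in\mathbb{R}^n$, $u(t)\in\mathbb{R}$. Let $k\in\mathbb{R}^n$ and $M_0,M_1,\dots,M_n>0$, $\mu>0$ be a vector and constants such that for every $v\in L^\infty_{loc}(\mathbb{R}^+;\mathbb{R}^n)$, $d\in L^\infty_{loc}(\mathbb{R}^+;D)$, $(t_0,x_0)\in\mathbb{R}^+\times\mathbb{R}^n$, the solution $x(t)$ of the closed-loop system $(\mathrm{S})$ with $u=k'x$, corresponding to inputs $v,d$, with initial condition $x(t_0)=x_0$ satisfies $$|x(t)|\le M_0\exp(-\mu(t-t_0))|x_0|+\sum_{i=1}^n M_i\sup_{t_0\le\tau\le t}\{\exp(-\mu(t-\tau))|v_i(\tau)|\},\quad\forall t\ge t_0 .$$ Moreover, let $\Delta_h^n:L^\infty_{loc}([-(n-1)h,0];\mathbb{R})\to\mathbb{R}^n$ ($h\in(0,1]$) be the family of linear operators defined in the context, and let $K_0,K_1,\dots,K_n>0$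 be constants for which properties (i) and (ii) of the context hold for every $h\in(0,1]$. Then for every $h\in(0,1]$ that satisfies $$\beta hK_n|k|\exp(\mu(n-1)h)<1\quad\text{and}\quad \frac{hK_nM_n\beta^2|k|^2\exp(\mu(n-1)h)}{\left(1-\beta hK_n|k|\exp(\mu(n-1)h)\right)^2}<1,$$ there exist constants $Q_0,Q_1,\dots,Q_n,Q_e>0$ such that for every $v\in L^\infty_{loc}(\mathbb{R}^+;\mathbb{R}^n)$, $e\in L^\infty_{loc}(\mathbb{R};\mathbb{R})$, $d\in L^\infty_{loc}(\mathbb{R}^+;D)$ and $x_0\in C^0([-(n-1)h,0];\mathbb{R}^n)$, the solution $x(t)$ of the closed-loop system $(\mathrm{S})$ with $$u(t)=k'\Delta_h^nT_{(n-1)h}(t)(x_1+e),$$ corresponding to inputs $v,e,d$, with initial condition $x(\theta)=x_0(\theta)$, $\theta\in[-(n-1)h,0]$, satisfies for all $t\ge0$: $$|x(t)|\le Q_0\exp(-\mu t)\sup_{-(n-1)h\le\theta\le0}|x(\theta)|+\sum_{i=1}^nQ_i\sup_{0\le\tau\le t}\exp(-\mu(t-\tau))|v_i(\tau)|+Q_e\sup_{-(n-1)h\le\tau\le t}\exp(-\mu(t-\tau))|e(\tau)|.$$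
   Context: $\mathbb{R}^+=[0,+\infty)$; $|x|$ is the Euclidean norm of a vector and $x'$ denotes the transpose. $L^\infty_{loc}(I;U)$ is the space of measurable and locally essentially bounded functions on $I$ with values in $U$; throughout, the $\sup$ of a measurable, (locally) essentially bounded function means its essential supremum. $C^0(A;\Omega)$ is the class of continuous functions on $A$ with values in $\Omega$. For a function $y$ defined on $[t-r,t]$, $T_r(t)y$ denotes its $r$-history at time $t$, i.e. the function $\theta\mapsto y(t+\theta)$, $\theta\in[-r,0]$. Operators: for $h\in(0,1]$ and $y\in L^\infty_{loc}([-(n-1)h,0];\mathbb{R})$, $$\Delta_h^ny:=Q_h^nP^{-1}\,[\,y(0)\;\;y(-h)\;\;y(-2h)\;\cdots\;y(-(n-1)h)\,]'\in\mathbb{R}^n,$$ where $Q_h^n=\mathrm{diag}\left(1,\frac{1!}{(-h)},\frac{2!}{(-h)^2},\dots,\frac{(n-1)!}{(-h)^{n-1}}\right)\in\mathbb{R}^{n\times n}$ and $P\in\mathbb{R}^{n\times n}$ is the (invertible) Vandermonde matrix with entries $P_{ij}=(i-1)^{j-1}$, $i,j=1,\dots,n$ (with $0^0=1$). Properties of the constants $K_0,\dots,K_n$ (for every $h\in(0,1]$): (i) for all $u_1,\dots,u_n\in L^\infty_{loc}(\mathbb{R}^+;\mathbb{R})$, $t_0\ge0$, $x_0\in\mathbb{R}^n$, the solution of $\dot x_i=x_{i+1}+u_i$ ($i=1,\dots,n-1$), $\dot x_n=u_n$, $x(t_0)=x_0$ satisfies $$\left|x(t)-\Delta_h^nT_{(n-1)h}(t)x_1\right|\le\sum_{j=1}^nK_jh^{j+1-n}\sup_{t-(n-1)h\le\tau\le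 t}|u_j(\tau)|,\quad\forall t\ge t_0+(n-1)h;$$ (ii) $h^{n-1}|\Delta_h^ny|\le K_0\sup_{-(n-1)h\le\tau\le0}|y(\tau)|$ for all $y\in L^\infty_{loc}([-(n-1)h,0];\mathbb{R})$. *)

theory Defs
  imports "HOL-Probability.Essential_Supremum"
begin

text \<open>
  The space \<open>\<real>\<^sup>n\<close> is \<^typ>\<open>real^'n\<close> with \<open>n = CARD('n)\<close>; the linear order on the index type
  numbers the coordinates. \<open>pos\<close> is the (1-based) number of an index and \<open>idx i\<close> is the
  \<open>i\<close>-th index, so that \<open>x $ idx i\<close> is the \<open>i\<close>-th coordinate for \<open>1 \<le> i \<le> n\<close>.
\<close>

definition pos :: "'n::{finite,linorder} \<Rightarrow> nat" where
  "pos j = card {m. m \<le> j}"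

definition idx :: "nat \<Rightarrow> 'n::{finite,linorder}" where
  "idx = inv pos"

lemma pos_inj: "inj (pos :: 'n::{finite,linorder} \<Rightarrow> nat)"
proof -
  have "pos i < pos j" if "i < j" for i j :: 'n
  proof -
    have "j \<in> {m. m \<le> j} - {m. m \<le> i}" "{m. m \<le> i} \<subseteq> {m. m \<le> j}"
      using that by auto
    then have "{m. m \<le> i} \<subset> {m. m \<le> j}"
      by blast
    then show ?thesis
      unfolding pos_def by (intro psubset_card_mono) auto
  qed
  then have "strict_mono (pos :: 'n \<Rightarrow> nat)"
    by (simp add: strict_mono_def)
  then show ?thesis
    by (rule strict_mono_imp_inj_on)
qed

lemma range_pos: "range (pos :: 'n::{finite,linorder} \<Rightarrow> nat) = {1..CARD('n)}"
proof (rule card_subset_eq)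
  have "1 \<le> pos j" for j :: 'n
    unfolding pos_def by (simp add: Suc_le_eq card_gt_0_iff) auto
  moreover have "pos j \<le> CARD('n)" for j :: 'n
    unfolding pos_def by (intro card_mono) auto
  ultimately show "range (pos :: 'n \<Rightarrow> nat) \<subseteq> {1..CARD('n)}" by auto
  show "card (range (pos :: 'n \<Rightarrow> nat)) = card {1..CARD('n)}"
    by (simp add: card_image pos_inj)
qed simp

lemma idx_pos [simp]: "idx (pos j) = j"
  by (simp add: idx_def pos_inj)

lemma pos_idx: "i \<in> {1..CARD('n)} \<Longrightarrow> pos (idx i :: 'n::{finite,linorder}) = i"
  unfolding idx_def range_pos[symmetric, where 'n='n] by (rule f_inv_into_f)

definition locally_lipschitz_on ::
    "'a::metric_space set \<Rightarrow> ('a \<Rightarrow> 'b::metric_space) \<Rightarrow> bool" where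
  "locally_lipschitz_on S f \<longleftrightarrow> (\<forall>p\<in>S. \<exists>\<epsilon>>0. \<exists>L. L-lipschitz_on (cball p \<epsilon> \<inter> S) f)"

text \<open>
  Elements of \<open>Linf_loc I U\<close> are functions, not classes modulo null sets; only their values on
  \<open>I\<close> matter.
\<close>

definition Linf_loc :: "real set \<Rightarrow> 'b::real_normed_vector set \<Rightarrow> (real \<Rightarrow> 'b) set" where
  "Linf_loc I U = {f. f \<in> borel_measurable (lebesgue_on I) \<and> (\<forall>t\<in>I. f t \<in> U) \<and>
     (\<forall>C. compact C \<and> C \<subseteq> I \<longrightarrow> (\<exists>B. AE t in lebesgue_on C. norm (f t) \<le> B))}"

text \<open>
  The library's \<^const>\<open>esssup\<close> is \<open>-\<infinity>\<close> on a null set (such as the degenerate interval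
  \<open>{t..t}\<close>), which \<^const>\<open>real_of_ereal\<close> turns into \<open>0\<close>, the right convention for the
  nonnegative functions to which \<open>ess_sup\<close> is applied. The value \<open>\<infinity>\<close> does not occur for
  measurable, essentially bounded functions.
\<close>

definition ess_sup :: "real set \<Rightarrow> (real \<Rightarrow> real) \<Rightarrow> real" where
  "ess_sup S f = real_of_ereal (esssup (lebesgue_on S) (\<lambda>t. ereal (f t)))"

text \<open>
  The operator \<open>\<Delta>\<close> evaluates its argument at individual points, so an estimate of \<open>\<Delta> y\<close> for all
  functions \<open>y\<close> has to use the pointwise supremum of \<open>\<bar>y\<bar>\<close>: with the essential supremum it would
  fail for every constant (change \<open>y\<close> at the single point \<open>0\<close>). The pointwise supremum of an
  essentially bounded function may be \<open>\<infinity>\<close>.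
\<close>

definition pointwise_sup_abs :: "real set \<Rightarrow> (real \<Rightarrow> real) \<Rightarrow> ennreal" where
  "pointwise_sup_abs S y = (SUP t\<in>S. ennreal \<bar>y t\<bar>)"

definition history :: "real \<Rightarrow> real \<Rightarrow> (real \<Rightarrow> 'b) \<Rightarrow> real \<Rightarrow> 'b" where
  "history r t y = (\<lambda>\<theta>\<in>{-r..0}. y (t + \<theta>))"

definition Vmat :: "real^'n::{finite,linorder}^'n::_" where
  "Vmat = (\<chi> i j. real (pos i - 1) ^ (pos j - 1))"

definition Qmat :: "real \<Rightarrow> real^'n::{finite,linorder}^'n::_" where
  "Qmat h = (\<chi> i j. if i = j then fact (pos i - 1) / (- h) ^ (pos i - 1) else 0)"

definition Delta :: "real \<Rightarrow> (real \<Rightarrow> real) \<Rightarrow> real^'n::{finite,linorder}" where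
  "Delta h y = (Qmat h ** matrix_inv Vmat) *v (\<chi> i. y (- (real (pos i - 1) * h)))"

text \<open>
  Caratheodory solutions on \<open>[t\<^sub>0, \<infinity>)\<close> in integral form: \<open>f\<close> is the right-hand side evaluated
  along \<open>x\<close>, i.e. \<open>x\<close> is locally absolutely continuous with \<open>x' = f\<close> almost everywhere.
\<close>

definition caratheodory_solution ::
    "real \<Rightarrow> (real \<Rightarrow> 'b::euclidean_space) \<Rightarrow> (real \<Rightarrow> 'b) \<Rightarrow> bool" where
  "caratheodory_solution t0 f x \<longleftrightarrow>
     (\<forall>t\<ge>t0. f absolutely_integrable_on {t0..t} \<and> x t = x t0 + integral {t0..t} f)"

definition chain_rhs ::
    "(real \<Rightarrow> real^'n::{finite,linorder}) \<Rightarrow> (real \<Rightarrow> real^'n::_) \<Rightarrow> real \<Rightarrow> real^'n::_" where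
  "chain_rhs u x t = (\<chi> i. if pos i < CARD('n) then x t $ idx (pos i + 1) + u t $ i
                          else u t $ i)"

definition system_rhs ::
    "('d \<times> (real^'n::{finite,linorder}) \<Rightarrow> real) \<Rightarrow> (real \<Rightarrow> 'd) \<Rightarrow> (real \<Rightarrow> real^'n::_) \<Rightarrow>
     (real \<Rightarrow> real) \<Rightarrow> (real \<Rightarrow> real^'n::_) \<Rightarrow> real \<Rightarrow> real^'n::_" where
  "system_rhs a d v u x t = (\<chi> i. if pos i < CARD('n) then x t $ idx (pos i + 1) + v t $ i
                                 else v t $ i + a (d t, x t) * u t)"

end

theory Submission
  imports Defs
begin

text \<open>
  Fix a final time \<open>T\<close> and weigh everything by \<open>\<phi> \<tau> = exp (- \<mu> * (T - \<tau>))\<close>. All data enter only through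
  one number \<open>G\<close>, the sum of the weighted suprema of the history and of the inputs \<open>v\<close> and \<open>e\<close>. Let
  \<open>Y = x - \<Delta> x\<^sub>1\<close> be the observation error, so that \<open>u = k \<bullet> x + k \<bullet> (\<Delta> e - Y)\<close>.

  On \<open>[0, r]\<close>, where \<open>r = (n - 1) h\<close>, a Gronwall argument bounds \<open>\<phi> \<bar>x\<bar>\<close> and \<open>\<phi> \<bar>Y\<bar>\<close> by multiples of \<open>G\<close>.
  For later times, \<open>x\<close> solves the chain of integrators with input \<open>a u\<close> in the last equation, and property (i)
  gives \<open>\<phi> \<bar>Y\<bar> \<le> C G + \<delta> (sup \<phi> \<bar>x\<bar> + sup \<phi> \<bar>Y\<bar>)\<close> with \<open>\<delta> < 1\<close> by the first smallness condition.
  On the other hand, \<open>x\<close> solves the nominal closed loop with the extra input \<open>a k \<bullet> (\<Delta> e - Y)\<close> in the last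
  equation, so \<open>\<phi> \<bar>x\<bar> \<le> C G + M\<^sub>n \<beta> \<bar>k\<bar> sup \<phi> \<bar>Y\<bar>\<close>. Combining the two, the loop gain is
  \<open>M\<^sub>n \<beta> \<bar>k\<bar> \<delta> / (1 - \<delta>)\<close>, which is less than \<open>1\<close> by the second smallness condition.
\<close>

section \<open>Essential suprema and locally essentially bounded functions\<close>

lemma AE_lebesgue_on_iff:
  "S \<in> sets lebesgue \<Longrightarrow>
    (AE t in lebesgue_on S. P t) \<longleftrightarrow> (AE t in lebesgue. t \<in> S \<longrightarrow> P t)"
  by (rule AE_restrict_space_iff) auto

lemma AE_lebesgue_iff_negligible:
  "(AE t in lebesgue. P t) \<longleftrightarrow> negligible {t. \<not> P t}"
  for P :: "'a::euclidean_space \<Rightarrow> bool"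
  unfolding negligible_iff_null_sets
proof
  assume "AE t in lebesgue. P t"
  then obtain N where "N \<in> null_sets lebesgue" "{t. \<not> P t} \<subseteq> N"
    by (auto simp: eventually_ae_filter)
  then show "{t. \<not> P t} \<in> null_sets lebesgue"
    using negligible_iff_null_sets negligible_subset by blast
next
  assume "{t. \<not> P t} \<in> null_sets lebesgue"
  then show "AE t in lebesgue. P t"
    by (rule AE_I') auto
qed

text \<open>Translations preserve null sets. This carries almost-everywhere bounds on
  \<open>e\<close> over to its delayed samples.\<close>

lemma AE_lebesgue_shift:
  fixes P :: "real \<Rightarrow> bool"
  assumes "AE t in lebesgue. P t"
  shows "AE t in lebesgue. P (t - c)"
proof -
  have "negligible ((+) c ` {t. \<not> P t})"
    using assms by (simp add: AE_lebesgue_iff_negligible negligible_translation)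
  also have "(+) c ` {t. \<not> P t} = {t. \<not> P (t - c)}"
    by (auto simp: image_iff) (metis add.commute diff_add_cancel)
  finally show ?thesis
    by (simp add: AE_lebesgue_iff_negligible)
qed

lemma measurable_lebesgue_shift:
  fixes f :: "real \<Rightarrow> 'b::real_normed_vector"
  assumes "f \<in> borel_measurable lebesgue"
  shows "(\<lambda>t. f (t - c)) \<in> borel_measurable lebesgue"
proof -
  have "(\<lambda>t::real. - c + t) \<in> lebesgue \<rightarrow>\<^sub>M lebesgue"
    using lebesgue_affine_measurable[where c="\<lambda>_::real. 1" and t="- c"] by simp
  from measurable_comp[OF this assms] show ?thesis
    by (simp add: comp_def)
qed

text \<open>For a nonmeasurable \<open>f\<close> the \<open>esssup\<close> is infinite, and on a
  null set it is minus infinity; \<open>real_of_ereal\<close> sends both to 0, and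
  \<open>0 \<le> c\<close> covers these cases.\<close>

lemma ess_sup_le:
  assumes "S \<in> sets lebesgue" "AE t in lebesgue. t \<in> S \<longrightarrow> f t \<le> c" "0 \<le> c"
  shows "ess_sup S f \<le> c"
proof (cases "(\<lambda>t. ereal (f t)) \<in> borel_measurable (lebesgue_on S)")
  case True
  have "esssup (lebesgue_on S) (\<lambda>t. ereal (f t)) \<le> ereal c"
    using assms(2) by (intro esssup_I True) (simp add: AE_lebesgue_on_iff assms(1))
  then show ?thesis
    unfolding ess_sup_def using \<open>0 \<le> c\<close>
    by (cases "esssup (lebesgue_on S) (\<lambda>t. ereal (f t))") auto
next
  case False
  then show ?thesis
    using \<open>0 \<le> c\<close> by (simp add: ess_sup_def esssup_non_measurable top_ereal_def)
qed

text \<open>A finite essential supremum forces \<open>f\<close> to be measurable and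
  \<open>S\<close> to be non-null, so some value of \<open>f\<close> lies below it. Infinite ones
  are turned into 0.\<close>

lemma ess_sup_nonneg:
  assumes "S \<in> sets lebesgue" "\<And>t. 0 \<le> f t"
  shows "0 \<le> ess_sup S f"
proof (cases "esssup (lebesgue_on S) (\<lambda>t. ereal (f t))")
  case (real z)
  have meas: "(\<lambda>t. ereal (f t)) \<in> borel_measurable (lebesgue_on S)"
    using real esssup_non_measurable by (force simp: top_ereal_def)
  have "AE t in lebesgue_on S. ereal (f t) \<le> z"
    using esssup_AE[where M="lebesgue_on S" and f="\<lambda>t. ereal (f t)"] real by simp
  moreover have "\<not> (AE t in lebesgue_on S. False)"
  proof
    assume "AE t in lebesgue_on S. False"
    then have "AE t in lebesgue_on S. ereal (f t) \<le> - \<infinity>"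
      by (rule AE_mp) simp
    from esssup_I[OF meas this] real show False by simp
  qed
  ultimately have "0 \<le> z"
    using assms(2) by (smt (verit, ccfv_threshold) AE_mp eventually_mono ereal_less_eq(3))
  then show ?thesis
    by (simp add: ess_sup_def real)
qed (auto simp: ess_sup_def)

text \<open>The bound \<open>c\<close> excludes the value infinity, and no real number lies below
  minus infinity, so \<open>real_of_ereal\<close> does no harm.\<close>

lemma AE_le_ess_sup:
  assumes S: "S \<in> sets lebesgue" and f: "f \<in> borel_measurable (lebesgue_on S)"
    and bound: "AE t in lebesgue. t \<in> S \<longrightarrow> f t \<le> c"
  shows "AE t in lebesgue. t \<in> S \<longrightarrow> f t \<le> ess_sup S f"
proof -
  let ?s = "esssup (lebesgue_on S) (\<lambda>t. ereal (f t))"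
  have "?s \<le> ereal c"
    using f bound by (intro esssup_I) (auto simp: AE_lebesgue_on_iff S)
  then have "ereal (f t) \<le> ?s \<Longrightarrow> f t \<le> ess_sup S f" for t
    unfolding ess_sup_def by (cases ?s) auto
  moreover have "AE t in lebesgue. t \<in> S \<longrightarrow> ereal (f t) \<le> ?s"
    using esssup_AE[where M="lebesgue_on S" and f="\<lambda>t. ereal (f t)"] by (simp add: AE_lebesgue_on_iff S)
  ultimately show ?thesis
    by (auto elim!: eventually_mono)
qed

text \<open>A continuous weight is bounded on a compact interval, so the weighted function stays
  essentially bounded. It is applied to the exponential weights of the estimate.\<close>

lemma AE_weighted_le_ess_sup:
  fixes f w :: "real \<Rightarrow> real"
  assumes f: "f \<in> Linf_loc I U" and I: "{a..b} \<subseteq> I" and w: "continuous_on {a..b} w"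
  shows "AE t in lebesgue. t \<in> {a..b} \<longrightarrow>
    w t * \<bar>f t\<bar> \<le> ess_sup {a..b} (\<lambda>t. w t * \<bar>f t\<bar>)"
proof -
  obtain B where B: "AE t in lebesgue. t \<in> {a..b} \<longrightarrow> norm (f t) \<le> B"
    using f I by (auto simp: Linf_loc_def AE_lebesgue_on_iff)
  have "bounded (w ` {a..b})"
    by (simp add: compact_continuous_image compact_imp_bounded w)
  then obtain W where W: "W > 0" "\<And>t. t \<in> {a..b} \<Longrightarrow> \<bar>w t\<bar> \<le> W"
    by (force simp: bounded_pos)
  have "AE t in lebesgue. t \<in> {a..b} \<longrightarrow> w t * \<bar>f t\<bar> \<le> W * \<bar>B\<bar>"
    using B
  proof (rule eventually_mono, intro impI)
    fix t assume *: "t \<in> {a..b} \<longrightarrow> norm (f t) \<le> B" "t \<in> {a..b}"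
    show "w t * \<bar>f t\<bar> \<le> W * \<bar>B\<bar>"
      using * W(1) W(2)[of t] by (intro mult_mono) auto
  qed
  moreover have "(\<lambda>t. w t * \<bar>f t\<bar>) \<in> borel_measurable (lebesgue_on {a..b})"
  proof (intro borel_measurable_times borel_measurable_abs)
    show "w \<in> borel_measurable (lebesgue_on {a..b})"
      using w by (intro continuous_imp_measurable_on_sets_lebesgue) auto
    show "f \<in> borel_measurable (lebesgue_on {a..b})"
      using f I by (auto simp: Linf_loc_def intro: measurable_restrict_mono)
  qed
  ultimately show ?thesis
    by (intro AE_le_ess_sup) auto
qed

lemma Linf_locI:
  assumes "f \<in> borel_measurable (lebesgue_on I)"
    and "\<And>C. compact C \<Longrightarrow> C \<subseteq> I \<Longrightarrow> \<exists>B. AE t in lebesgue_on C. norm (f t) \<le> B"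
  shows "f \<in> Linf_loc I UNIV"
  using assms by (auto simp: Linf_loc_def)

lemma Linf_loc_bounded_linear:
  fixes T :: "'a::{second_countable_topology, real_normed_vector} \<Rightarrow> 'b::{second_countable_topology, real_normed_vector}"
  assumes f: "f \<in> Linf_loc I U" and T: "bounded_linear T"
  shows "(\<lambda>t. T (f t)) \<in> Linf_loc I UNIV"
proof (rule Linf_locI)
  have "T \<in> borel_measurable borel"
    by (intro borel_measurable_continuous_onI linear_continuous_on T)
  then show "(\<lambda>t. T (f t)) \<in> borel_measurable (lebesgue_on I)"
    using f measurable_compose by (auto simp: Linf_loc_def)
next
  fix C assume "compact C" "C \<subseteq> I"
  then obtain B where "AE t in lebesgue_on C. norm (f t) \<le> B"
    using f by (auto simp: Linf_loc_def)
  moreover obtain c where "\<And>x. norm (T x) \<le> norm x * c" "c > 0"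
    using bounded_linear.pos_bounded[OF T] by blast
  ultimately have "AE t in lebesgue_on C. norm (T (f t)) \<le> B * c"
    by (smt (verit, best) eventually_mono mult_right_mono)
  then show "\<exists>B. AE t in lebesgue_on C. norm (T (f t)) \<le> B" ..
qed

lemma Linf_loc_add:
  fixes f g :: "real \<Rightarrow> 'b::{second_countable_topology, real_normed_vector}"
  assumes f: "f \<in> Linf_loc I U" and g: "g \<in> Linf_loc I V"
  shows "(\<lambda>t. f t + g t) \<in> Linf_loc I UNIV"
proof (rule Linf_locI)
  show "(\<lambda>t. f t + g t) \<in> borel_measurable (lebesgue_on I)"
    using f g by (auto simp: Linf_loc_def)
next
  fix C assume "compact C" "C \<subseteq> I"
  then obtain A B where "AE t in lebesgue_on C. norm (f t) \<le> A" "AE t in lebesgue_on C. norm (g t) \<le> B"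
    using f g by (auto simp: Linf_loc_def) metis
  then have "AE t in lebesgue_on C. norm (f t + g t) \<le> A + B"
    by eventually_elim (rule norm_add_rule_thm)
  then show "\<exists>B. AE t in lebesgue_on C. norm (f t + g t) \<le> B" ..
qed

lemma Linf_loc_mult:
  fixes f g :: "real \<Rightarrow> real"
  assumes f: "f \<in> Linf_loc I U" and g: "g \<in> Linf_loc I V"
  shows "(\<lambda>t. f t * g t) \<in> Linf_loc I UNIV"
proof (rule Linf_locI)
  show "(\<lambda>t. f t * g t) \<in> borel_measurable (lebesgue_on I)"
    using f g by (auto simp: Linf_loc_def)
next
  fix C assume "compact C" "C \<subseteq> I"
  then obtain A B where "AE t in lebesgue_on C. norm (f t) \<le> A" "AE t in lebesgue_on C. norm (g t) \<le> B"
    using f g by (auto simp: Linf_loc_def) metis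
  then have "AE t in lebesgue_on C. norm (f t * g t) \<le> A * B"
    by eventually_elim (auto simp: abs_mult intro!: mult_mono)
  then show "\<exists>B. AE t in lebesgue_on C. norm (f t * g t) \<le> B" ..
qed

lemma Linf_loc_continuous:
  fixes f :: "real \<Rightarrow> 'b::real_normed_vector"
  assumes f: "continuous_on I f" and I: "I \<in> sets lebesgue"
  shows "f \<in> Linf_loc I UNIV"
proof (rule Linf_locI)
  show "f \<in> borel_measurable (lebesgue_on I)"
    using assms by (rule continuous_imp_measurable_on_sets_lebesgue)
next
  fix C assume "compact C" "C \<subseteq> I"
  then have "bounded (f ` C)"
    using f by (intro compact_imp_bounded compact_continuous_image) (auto intro: continuous_on_subset)
  then obtain B where "\<And>t. t \<in> C \<Longrightarrow> norm (f t) \<le> B"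
    by (auto simp: bounded_iff)
  moreover have "C \<in> sets lebesgue"
    using \<open>compact C\<close> lmeasurable_compact by blast
  ultimately have "AE t in lebesgue_on C. norm (f t) \<le> B"
    by (simp add: AE_lebesgue_on_iff)
  then show "\<exists>B. AE t in lebesgue_on C. norm (f t) \<le> B" ..
qed

lemma Linf_loc_sum:
  fixes f :: "'i \<Rightarrow> real \<Rightarrow> 'b::{second_countable_topology, real_normed_vector}"
  assumes "finite A" "\<And>i. i \<in> A \<Longrightarrow> f i \<in> Linf_loc I UNIV" "I \<in> sets lebesgue"
  shows "(\<lambda>t. \<Sum>i\<in>A. f i t) \<in> Linf_loc I UNIV"
  using assms
proof (induction A rule: finite_induct)
  case empty
  then show ?case
    using Linf_loc_continuous[of I "\<lambda>_. 0"] by simp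
next
  case (insert i A)
  then show ?case
    using Linf_loc_add[of "f i" I UNIV "\<lambda>t. \<Sum>i\<in>A. f i t" UNIV] by simp
qed

lemma Linf_loc_shift:
  fixes e :: "real \<Rightarrow> 'b::real_normed_vector"
  assumes e: "e \<in> Linf_loc UNIV UNIV" and I: "I \<in> sets lebesgue"
  shows "(\<lambda>t. e (t - c)) \<in> Linf_loc I UNIV"
proof (rule Linf_locI)
  have "(\<lambda>t. e (t - c)) \<in> borel_measurable lebesgue"
    using e by (intro measurable_lebesgue_shift) (simp add: Linf_loc_def lebesgue_on_UNIV_eq)
  then show "(\<lambda>t. e (t - c)) \<in> borel_measurable (lebesgue_on I)"
    using measurable_restrict_space1 by blast
next
  fix C assume C: "compact C" "C \<subseteq> I"
  have C': "compact ((\<lambda>t. t - c) ` C)"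
    using C by (intro compact_continuous_image) (auto intro: continuous_intros)
  then obtain B where "AE t in lebesgue_on ((\<lambda>t. t - c) ` C). norm (e t) \<le> B"
    using e by (auto simp: Linf_loc_def)
  then have "AE t in lebesgue. t \<in> (\<lambda>t. t - c) ` C \<longrightarrow> norm (e t) \<le> B"
    using C' lmeasurable_compact by (subst (asm) AE_lebesgue_on_iff) blast+
  from AE_lebesgue_shift[OF this, of c]
  have "AE t in lebesgue. t \<in> C \<longrightarrow> norm (e (t - c)) \<le> B"
    by (rule eventually_mono) auto
  then have "AE t in lebesgue_on C. norm (e (t - c)) \<le> B"
    using C lmeasurable_compact by (subst AE_lebesgue_on_iff) blast+
  then show "\<exists>B. AE t in lebesgue_on C. norm (e (t - c)) \<le> B" ..
qed

section \<open>Caratheodory solutions and the coefficient\<close>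

lemma locally_lipschitz_on_imp_continuous_on:
  assumes "locally_lipschitz_on S f"
  shows "continuous_on S f"
  unfolding continuous_on_eq_continuous_within
proof
  fix p assume p: "p \<in> S"
  then obtain \<epsilon> L where \<epsilon>: "\<epsilon> > 0" "L-lipschitz_on (cball p \<epsilon> \<inter> S) f"
    using assms by (auto simp: locally_lipschitz_on_def)
  then have "continuous (at p within cball p \<epsilon> \<inter> S) f"
    using lipschitz_on_continuous_within p by fastforce
  moreover have "at p within cball p \<epsilon> \<inter> S = at p within S"
    using \<epsilon>(1) by (intro at_within_nhd[of p "ball p \<epsilon>"]) auto
  ultimately show "continuous (at p within S) f"
    by simp
qed

text \<open>An indefinite integral is continuous on compact intervals, and \<open>{t0..t+1}\<close>
  is a neighbourhood of \<open>t\<close> within \<open>{t0..}\<close>.\<close>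

lemma caratheodory_solution_continuous_on:
  assumes "caratheodory_solution t0 f x"
  shows "continuous_on {t0..} x"
  unfolding continuous_on_eq_continuous_within
proof
  fix t assume t: "t \<in> {t0..}"
  have "f integrable_on {t0..t+1}"
  proof (rule set_lebesgue_integral_eq_integral(1))
    have "t0 \<le> t + 1"
      using t by simp
    then show "f absolutely_integrable_on {t0..t+1}"
      using assms unfolding caratheodory_solution_def by blast
  qed
  then have "continuous_on {t0..t+1} (\<lambda>s. x t0 + integral {t0..s} f)"
    by (intro continuous_intros indefinite_integral_continuous_1)
  then have "continuous_on {t0..t+1} x"
  proof (rule continuous_on_eq)
    fix s assume "s \<in> {t0..t+1}"
    then have "t0 \<le> s"
      by simp
    with assms have "x s = x t0 + integral {t0..s} f"
      unfolding caratheodory_solution_def by blast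
    then show "x t0 + integral {t0..s} f = x s" ..
  qed
  then have "continuous (at t within {t0..t+1}) x"
    using t by (simp add: continuous_on_eq_continuous_within)
  moreover have "at t within {t0..t+1} = at t within {t0..}"
    using t by (intro at_within_nhd[of t "{..<t+1}"]) auto
  ultimately show "continuous (at t within {t0..}) x"
    by simp
qed

text \<open>Continuity of \<open>a\<close> on \<open>D \<times> UNIV\<close> gives measurability for
  the sigma-algebra restricted to that set; since \<open>d\<close> takes its values in
  \<open>D\<close>, the pair \<open>(d t, x t)\<close> is measurable into it.\<close>

lemma Linf_loc_coefficient:
  fixes a :: "'d::euclidean_space \<times> 'b::euclidean_space \<Rightarrow> real"
  assumes D: "compact D" and a: "continuous_on (D \<times> UNIV) a"
    and bound: "\<And>d x. d \<in> D \<Longrightarrow> \<bar>a (d, x)\<bar> \<le> \<beta>"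
    and d: "d \<in> Linf_loc {0..} D" and x: "continuous_on {0..} x"
  shows "(\<lambda>t. a (d t, x t)) \<in> Linf_loc {0..} UNIV"
proof (rule Linf_locI)
  have "x \<in> borel_measurable (lebesgue_on {0..})"
    using x by (intro continuous_imp_measurable_on_sets_lebesgue) auto
  then have "(\<lambda>t. (d t, x t)) \<in> borel_measurable (lebesgue_on {0..})"
    using d by (intro borel_measurable_Pair) (auto simp: Linf_loc_def)
  then have "(\<lambda>t. (d t, x t)) \<in> lebesgue_on {0..} \<rightarrow>\<^sub>M restrict_space borel (D \<times> UNIV)"
    using d by (intro measurable_restrict_space2) (auto simp: Linf_loc_def)
  from measurable_compose[OF this borel_measurable_continuous_on_restrict[OF a]]
  show "(\<lambda>t. a (d t, x t)) \<in> borel_measurable (lebesgue_on {0..})" .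
next
  fix C :: "real set" assume C: "compact C" "C \<subseteq> {0..}"
  then have "C \<in> sets lebesgue"
    using lmeasurable_compact by blast
  moreover have "\<bar>a (d t, x t)\<bar> \<le> \<beta>" if "t \<in> C" for t
    using that C d by (intro bound) (auto simp: Linf_loc_def)
  ultimately have "AE t in lebesgue_on C. norm (a (d t, x t)) \<le> \<beta>"
    by (simp add: AE_lebesgue_on_iff)
  then show "\<exists>B. AE t in lebesgue_on C. norm (a (d t, x t)) \<le> B" ..
qed

section \<open>The operator \<open>\<Delta>\<close>\<close>

lemma delay_le:
  fixes i :: "'n::{finite,linorder}"
  assumes "0 \<le> h"
  shows "real (pos i - 1) * h \<le> real (CARD('n) - 1) * h"
proof -
  have "pos i - 1 \<le> CARD('n) - 1"
    using range_pos[where 'n='n] by (metis atLeastAtMost_iff diff_le_mono rangeI)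
  then show ?thesis
    using assms by (intro mult_right_mono of_nat_mono)
qed

text \<open>By \<open>delay_le\<close> all sample times lie in the window, so the restriction built
  into \<open>history\<close> is invisible. The right-hand side is manifestly linear in the
  samples.\<close>

lemma Delta_history:
  assumes "0 \<le> h"
  shows "Delta h (history (real (CARD('n) - 1) * h) t y) =
    (Qmat h ** matrix_inv Vmat) *v (\<chi> i::'n::{finite,linorder}. y (t - real (pos i - 1) * h))"
proof -
  show ?thesis
    unfolding Delta_def history_def using assms delay_le[OF assms, where 'n='n] by simp
qed

lemma Delta_history_add:
  assumes "0 \<le> h"
  shows "(Delta h (history (real (CARD('n) - 1) * h) t (\<lambda>s. y s + z s)) :: real^'n::{finite,linorder}) =
    Delta h (history (real (CARD('n) - 1) * h) t y) + Delta h (history (real (CARD('n) - 1) * h) t z)"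
  unfolding Delta_history[OF assms] matrix_vector_right_distrib[symmetric]
  by (simp add: plus_vec_def)

text \<open>A matrix is a bounded linear map. The bound asks only for the sampled values, which
  suits an essentially bounded \<open>e\<close>: at almost every \<open>t\<close> all its samples
  are controlled. The constant depends on \<open>h\<close>, but on neither \<open>y\<close> nor
  \<open>t\<close>.\<close>

lemma Delta_history_bound:
  assumes "0 \<le> h"
  obtains c where "c > 0"
    and "\<And>y t B. (\<And>i::'n. \<bar>y (t - real (pos i - 1) * h)\<bar> \<le> B) \<Longrightarrow>
      norm (Delta h (history (real (CARD('n) - 1) * h) t y) :: real^'n::{finite,linorder}) \<le> c * B"
proof -
  let ?A = "Qmat h ** matrix_inv Vmat :: real^'n::_^'n::_"
  obtain c where c: "c > 0" "\<And>z. norm (?A *v z) \<le> norm z * c"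
    using bounded_linear.pos_bounded[OF matrix_vector_mul_bounded_linear[of ?A]] by blast
  show thesis
  proof
    show "0 < c * CARD('n)"
      using c by simp
    fix y :: "real \<Rightarrow> real" and t B assume B: "\<And>i::'n. \<bar>y (t - real (pos i - 1) * h)\<bar> \<le> B"
    let ?z = "\<chi> i::'n. y (t - real (pos i - 1) * h)"
    have "norm ?z \<le> (\<Sum>i\<in>UNIV. \<bar>?z $ i\<bar>)"
      by (rule norm_le_l1_cart)
    also have "\<dots> \<le> of_nat (card (UNIV :: 'n set)) * B"
      by (rule sum_bounded_above) (use B in simp)
    finally have "norm ?z \<le> CARD('n) * B" .
    then have "norm (?A *v ?z) \<le> CARD('n) * B * c"
      using c by (meson less_imp_le mult_right_mono order_trans)
    then show "norm (Delta h (history (real (CARD('n) - 1) * h) t y) :: real^'n::_) \<le> c * CARD('n) * B"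
      unfolding Delta_history[OF assms] by (simp add: mult_ac)
  qed
qed

lemma continuous_on_Delta_history:
  assumes h: "0 \<le> h" and y: "continuous_on {- (real (CARD('n) - 1) * h)..} y"
  shows "continuous_on {0..} (\<lambda>t. Delta h (history (real (CARD('n) - 1) * h) t y) :: real^'n::{finite,linorder})"
proof -
  have "continuous_on {0..} (\<lambda>t. y (t - real (pos i - 1) * h))" for i :: 'n
    using delay_le[OF h, of i] by (intro continuous_on_compose2[OF y] continuous_intros) auto
  then show ?thesis
    unfolding Delta_history[OF h]
    by (intro continuous_on_compose2[OF matrix_vector_mult_linear_continuous_on[where S=UNIV]] continuous_on_vec_lambda) auto
qed

lemma Linf_loc_Delta_history:
  assumes h: "0 \<le> h" and e: "e \<in> Linf_loc UNIV UNIV"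
  shows "(\<lambda>t. Delta h (history (real (CARD('n) - 1) * h) t e) :: real^'n::{finite,linorder}) \<in> Linf_loc {0..} UNIV"
proof -
  \<comment> \<open>Writing the vector of samples as a sum of shifted scalars times axis vectors
    reduces the claim to closure under shifts, linear maps and finite sums.\<close>
  have "(\<lambda>t. \<Sum>i\<in>UNIV. e (t - real (pos i - 1) * h) *\<^sub>R axis i (1::real)) \<in> Linf_loc {0..} UNIV"
    by (intro Linf_loc_sum Linf_loc_bounded_linear[OF Linf_loc_shift[OF e]] bounded_linear_scaleR_left) auto
  also have "(\<lambda>t. \<Sum>i\<in>UNIV. e (t - real (pos i - 1) * h) *\<^sub>R axis i (1::real)) =
      (\<lambda>t. \<chi> i::'n. e (t - real (pos i - 1) * h))"
    by (intro ext vec_eq_iff[THEN iffD2]) (simp add: axis_def if_distrib cong: if_cong)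
  finally show ?thesis
    unfolding Delta_history[OF h]
    by (rule Linf_loc_bounded_linear) (rule matrix_vector_mul_bounded_linear)
qed

section \<open>Small-gain and Gronwall estimates\<close>

text \<open>The a priori bound \<open>b\<close> makes the supremum \<open>?B\<close> of
  \<open>f\<close> finite, so \<open>?B \<le> d + c * ?B\<close> can be solved for \<open>?B\<close>
  when \<open>c < 1\<close>.\<close>

lemma small_gain:
  fixes f :: "'a \<Rightarrow> real"
  assumes bounded: "\<And>s. s \<in> S \<Longrightarrow> f s \<le> b" and nonneg: "\<And>s. s \<in> S \<Longrightarrow> 0 \<le> f s"
    and step: "\<And>B s. 0 \<le> B \<Longrightarrow> (\<And>s. s \<in> S \<Longrightarrow> f s \<le> B) \<Longrightarrow> s \<in> S \<Longrightarrow> f s \<le> d + c * B"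
    and c: "c < 1" and s: "s \<in> S"
  shows "f s \<le> d / (1 - c)"
proof -
  let ?B = "SUP s\<in>S. f s"
  have bdd: "bdd_above (f ` S)"
    using bounded by (auto simp: bdd_above_def)
  have le: "f s \<le> ?B" if "s \<in> S" for s
    using bdd that by (rule cSUP_upper2) simp
  then have "0 \<le> ?B"
    using nonneg s order_trans by blast
  then have "?B \<le> d + c * ?B"
    using s by (intro cSUP_least step le) auto
  then have "?B \<le> d / (1 - c)"
    using c by (simp add: field_simps)
  with le[OF s] show ?thesis by simp
qed

text \<open>
  The weight \<open>exp (- 2 * A * s)\<close> makes the integral operator a contraction with factor \<open>1/2\<close>.
\<close>

lemma delay_gronwall:
  fixes x :: "real \<Rightarrow> 'b::euclidean_space"
  assumes sol: "caratheodory_solution 0 f x" and A: "0 < A" and B: "0 \<le> B"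
    and init: "\<And>\<sigma>. \<sigma> \<in> {- r..0} \<Longrightarrow> norm (x \<sigma>) \<le> H" and r: "0 \<le> r"
    and f: "AE \<tau> in lebesgue. \<tau> \<in> {0..S} \<longrightarrow>
      (\<forall>Z. (\<forall>\<sigma>\<in>{- r..\<tau>}. norm (x \<sigma>) \<le> Z) \<longrightarrow> norm (f \<tau>) \<le> A * Z + B)"
    and s: "s \<in> {0..S}"
  shows "norm (x s) \<le> 2 * exp (2 * A * S) * (H * (1 + A * S) + B * S)"
proof -
  let ?\<psi> = "\<lambda>s. exp (- (2 * A * s)) * norm (x s)"
  have x0: "norm (x 0) \<le> H"
    using init r by simp
  then have H: "0 \<le> H"
    using norm_ge_zero order_trans by blast
  have S: "0 \<le> S"
    using s by simp
  have cont: "continuous_on {0..S} x"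
    using caratheodory_solution_continuous_on[OF sol] by (rule continuous_on_subset) auto
  then have "bounded (?\<psi> ` {0..S})"
    by (intro compact_imp_bounded compact_continuous_image continuous_intros) auto
  then obtain b where b: "\<And>s. s \<in> {0..S} \<Longrightarrow> ?\<psi> s \<le> b"
    by (force simp: bounded_iff)
  have "?\<psi> s \<le> (H * (1 + A * S) + B * S) / (1 - 1 / 2)"
  proof (rule small_gain[where S="{0..S}" and b=b and f="?\<psi>"])
    fix Z s assume Z: "0 \<le> Z" "\<And>s. s \<in> {0..S} \<Longrightarrow> ?\<psi> s \<le> Z" and s: "s \<in> {0..S}"
    \<comment> \<open>Off a null set \<open>g\<close> bounds \<open>norm (f \<tau>)\<close>:
      \<open>H\<close> accounts for the initial history, the exponential term for positive times.
      \<open>G\<close> is an antiderivative of \<open>g\<close>; integrating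
      \<open>A * Z * exp (2 * A * \<tau>)\<close> produces the contraction factor
      \<open>1/2\<close>.\<close>
    define g where "g \<tau> = A * (H + Z * exp (2 * A * \<tau>)) + B" for \<tau>
    define G where "G \<tau> = (A * H + B) * \<tau> + Z / 2 * exp (2 * A * \<tau>)" for \<tau>
    define N where "N = {\<tau>. \<not> (\<tau> \<in> {0..S} \<longrightarrow>
      (\<forall>Z. (\<forall>\<sigma>\<in>{- r..\<tau>}. norm (x \<sigma>) \<le> Z) \<longrightarrow> norm (f \<tau>) \<le> A * Z + B))}"
    have N: "negligible N"
      unfolding N_def using f by (simp only: AE_lebesgue_iff_negligible)
    have hist: "norm (x \<sigma>) \<le> H + Z * exp (2 * A * \<tau>)" if "\<tau> \<in> {0..S}" "\<sigma> \<in> {- r..\<tau>}" for \<sigma> \<tau>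
    proof (cases "\<sigma> \<le> 0")
      case True
      then show ?thesis
        using init[of \<sigma>] that Z(1) by (smt (verit) atLeastAtMost_iff exp_ge_zero mult_nonneg_nonneg)
    next
      case False
      then have "?\<psi> \<sigma> \<le> Z"
        using that by (intro Z(2)) auto
      then have "norm (x \<sigma>) \<le> Z * exp (2 * A * \<sigma>)"
        by (simp add: exp_minus field_simps)
      also have "\<dots> \<le> Z * exp (2 * A * \<tau>)"
        using that A Z(1) by (intro mult_left_mono) auto
      finally show ?thesis using H by simp
    qed
    have le: "norm (f \<tau>) \<le> g \<tau>" if "\<tau> \<in> {0..s}" "\<tau> \<notin> N" for \<tau>
    proof -
      have "\<forall>\<sigma>\<in>{- r..\<tau>}. norm (x \<sigma>) \<le> H + Z * exp (2 * A * \<tau>)"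
        using that s hist[of \<tau>] by simp
      moreover have "\<tau> \<in> {0..S}"
        using that s by simp
      ultimately show ?thesis
        using that(2) unfolding N_def g_def by blast
    qed
    have g: "(g has_integral G s - G 0) {0..s}"
      unfolding g_def G_def using s A
      by (intro fundamental_theorem_of_calculus)
        (auto intro!: derivative_eq_intros
          simp: has_real_derivative_iff_has_vector_derivative[symmetric] distrib_left)
    have "0 \<le> s"
      using s by simp
    then have f_int: "f integrable_on {0..s}" and x_eq: "x s = x 0 + integral {0..s} f"
      using sol set_lebesgue_integral_eq_integral(1) unfolding caratheodory_solution_def by blast+
    \<comment> \<open>Setting \<open>f\<close> to 0 on the null set \<open>N\<close> leaves the
      integral unchanged and makes the bound by the nonnegative \<open>g\<close> hold
      everywhere.\<close>
    let ?f = "\<lambda>\<tau>. if \<tau> \<in> N then 0 else f \<tau>"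
    have "integral {0..s} f = integral {0..s} ?f"
      by (rule integral_spike[OF N]) auto
    moreover have "norm (integral {0..s} ?f) \<le> integral {0..s} g"
    proof (rule integral_norm_bound_integral)
      show "?f integrable_on {0..s}"
        by (rule integrable_spike[OF f_int N]) auto
      show "g integrable_on {0..s}"
        using g by blast
      have "0 \<le> g \<tau>" for \<tau>
        unfolding g_def using A B H Z(1) by simp
      then show "norm (?f \<tau>) \<le> g \<tau>" if "\<tau> \<in> {0..s}" for \<tau>
        using le that by simp
    qed
    ultimately have "norm (x s) \<le> norm (x 0) + (G s - G 0)"
      using norm_triangle_ineq[of "x 0" "integral {0..s} f"] integral_unique[OF g]
      unfolding x_eq by simp
    also have "\<dots> \<le> H + (A * H + B) * s + Z / 2 * exp (2 * A * s)"
      unfolding G_def using x0 Z(1) by simp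
    also have "\<dots> \<le> exp (2 * A * s) * (H + (A * H + B) * S + Z / 2)"
    proof -
      have "H + (A * H + B) * s \<le> H + (A * H + B) * S"
        using s A B H by (intro add_left_mono mult_left_mono) auto
      also have "\<dots> \<le> exp (2 * A * s) * (H + (A * H + B) * S)"
        using mult_right_mono[of 1 "exp (2 * A * s)" "H + (A * H + B) * S"] s A B H by simp
      finally show ?thesis by (simp add: algebra_simps)
    qed
    finally show "?\<psi> s \<le> (H * (1 + A * S) + B * S) + 1 / 2 * Z"
      by (simp add: exp_minus field_simps)
  qed (use b s in auto)
  then have "norm (x s) \<le> exp (2 * A * s) * (2 * (H * (1 + A * S) + B * S))"
    by (simp add: exp_minus field_simps)
  also have "\<dots> \<le> exp (2 * A * S) * (2 * (H * (1 + A * S) + B * S))"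
    using s A B H by (intro mult_right_mono) auto
  finally show ?thesis by (simp add: algebra_simps)
qed

section \<open>The closed loop\<close>

theorem proposition2p3:
  fixes n :: nat
    and D :: "(real^'l) set"
    and a :: "(real^'l) \<times> (real^'n::{finite,linorder}) \<Rightarrow> real"
    and k :: "real^'n::_"
    and M K :: "nat \<Rightarrow> real"
    and \<alpha> \<beta> \<mu> h :: real
  assumes n_def: "n = CARD('n)" and n_ge_2: "n \<ge> 2"
    and D_compact: "compact D"
    and a_lipschitz: "locally_lipschitz_on (D \<times> UNIV) a"
    and \<alpha>_pos: "\<alpha> > 0" and \<beta>_pos: "\<beta> > 0"
    and a_bounds: "\<And>d x. d \<in> D \<Longrightarrow> \<alpha> \<le> a (d, x) \<and> a (d, x) \<le> \<beta>"
    and M_pos: "\<And>i. i \<le> n \<Longrightarrow> M i > 0" and \<mu>_pos: "\<mu> > 0"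
    and nominal_estimate: "\<And>v d t0 x0 x t.
        v \<in> Linf_loc {0..} UNIV \<Longrightarrow> d \<in> Linf_loc {0..} D \<Longrightarrow> t0 \<ge> 0 \<Longrightarrow>
        caratheodory_solution t0 (system_rhs a d v (\<lambda>s. k \<bullet> x s) x) x \<Longrightarrow> x t0 = x0 \<Longrightarrow>
        t \<ge> t0 \<Longrightarrow>
        norm (x t) \<le> M 0 * exp (- \<mu> * (t - t0)) * norm x0
          + (\<Sum>i=1..n. M i * ess_sup {t0..t} (\<lambda>\<tau>. exp (- \<mu> * (t - \<tau>)) * \<bar>v \<tau> $ idx i\<bar>))"
    and K_pos: "\<And>j. j \<le> n \<Longrightarrow> K j > 0"
    and property_i: "\<And>\<eta> u t0 x0 x t.
        0 < \<eta> \<Longrightarrow> \<eta> \<le> 1 \<Longrightarrow>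
        (\<And>i. (\<lambda>s. u s $ i) \<in> Linf_loc {0..} UNIV) \<Longrightarrow> t0 \<ge> 0 \<Longrightarrow>
        caratheodory_solution t0 (chain_rhs u x) x \<Longrightarrow> x t0 = (x0 :: real^'n::_) \<Longrightarrow>
        t \<ge> t0 + real (n - 1) * \<eta> \<Longrightarrow>
        norm (x t - Delta \<eta> (history (real (n - 1) * \<eta>) t (\<lambda>s. x s $ idx 1)))
          \<le> (\<Sum>j=1..n. K j * \<eta> powi (int j + 1 - int n)
               * ess_sup {t - real (n - 1) * \<eta>..t} (\<lambda>\<tau>. \<bar>u \<tau> $ idx j\<bar>))"
    and property_ii: "\<And>\<eta> y.
        0 < \<eta> \<Longrightarrow> \<eta> \<le> 1 \<Longrightarrow> y \<in> Linf_loc {- (real (n - 1) * \<eta>)..0} UNIV \<Longrightarrow>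
        ennreal (\<eta> ^ (n - 1) * norm (Delta \<eta> y :: real^'n::_))
          \<le> ennreal (K 0) * pointwise_sup_abs {- (real (n - 1) * \<eta>)..0} y"
    and h_pos: "0 < h" and h_le_1: "h \<le> 1"
    and small_gain_1: "\<beta> * h * K n * norm k * exp (\<mu> * real (n - 1) * h) < 1"
    and small_gain_2: "h * K n * M n * \<beta>\<^sup>2 * (norm k)\<^sup>2 * exp (\<mu> * real (n - 1) * h)
          / (1 - \<beta> * h * K n * norm k * exp (\<mu> * real (n - 1) * h))\<^sup>2 < 1"
  shows "\<exists>Q Qe. (\<forall>i\<le>n. Q i > 0) \<and> Qe > (0::real) \<and>
    (\<forall>v e d x0 x.
        v \<in> Linf_loc {0..} UNIV \<longrightarrow> e \<in> Linf_loc UNIV UNIV \<longrightarrow> d \<in> Linf_loc {0..} D \<longrightarrow>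
        continuous_on {- (real (n - 1) * h)..0} x0 \<longrightarrow>
        caratheodory_solution 0
          (system_rhs a d v
             (\<lambda>t. k \<bullet> Delta h (history (real (n - 1) * h) t (\<lambda>s. x s $ idx 1 + e s))) x) x \<longrightarrow>
        (\<forall>\<theta>\<in>{- (real (n - 1) * h)..0}. x \<theta> = x0 \<theta>) \<longrightarrow>
        (\<forall>t\<ge>0. norm (x t)
          \<le> Q 0 * exp (- \<mu> * t) * (SUP \<theta>\<in>{- (real (n - 1) * h)..0}. norm (x \<theta>))
            + (\<Sum>i=1..n. Q i * ess_sup {0..t} (\<lambda>\<tau>. exp (- \<mu> * (t - \<tau>)) * \<bar>v \<tau> $ idx i\<bar>))
            + Qe * ess_sup {- (real (n - 1) * h)..t} (\<lambda>\<tau>. exp (- \<mu> * (t - \<tau>)) * \<bar>e \<tau>\<bar>)))"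
proof -

  \<comment> \<open>Notation, constants and the loop gain\<close>
  define r where "r = real (n - 1) * h"
  define E where "E = exp (\<mu> * r)"
  define \<kappa> where "\<kappa> = norm k"
  define \<delta> where "\<delta> = \<beta> * h * K n * \<kappa> * E"
  define N where "N = (idx n :: 'n)"
  \<comment> \<open>Positions are 1-based, so the first sample has delay 0 and the last one has
    delay \<open>r\<close>.\<close>
  define dly where "dly i = real (pos i - 1) * h" for i :: 'n
  define \<Delta> where "\<Delta> y t = (Delta h (history r t y) :: real^'n::_)" for y t
  have r_eq: "r = real (CARD('n) - 1) * h"
    by (simp add: r_def n_def)
  have r: "0 \<le> r" and h0: "0 \<le> h"
    using h_pos by (auto simp: r_def)
  have E: "1 \<le> E"
    using \<mu>_pos r by (simp add: E_def)
  have \<kappa>: "0 \<le> \<kappa>"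
    by (simp add: \<kappa>_def)
  have dly: "0 \<le> dly i" "dly i \<le> r" for i
    using delay_le[OF h0, of i] h0 by (simp_all add: dly_def r_eq)
  have pos_N: "pos N = n"
    unfolding N_def n_def by (rule pos_idx) (use n_def n_ge_2 in auto)
  have pos_less: "pos i < n \<longleftrightarrow> i \<noteq> N" for i :: 'n
    using range_pos[where 'n='n] pos_N pos_inj[where 'n='n] unfolding n_def
    by (metis atLeastAtMost_iff inj_eq le_neq_implies_less less_irrefl rangeI)
  have idx_N: "idx j = N \<longleftrightarrow> j = n" if "j \<in> {1..n}" for j
    using that pos_idx[of j, where 'n='n] pos_N by (metis N_def n_def)
  have \<delta>: "0 \<le> \<delta>" "\<delta> < 1"
    using \<beta>_pos h0 K_pos[of n] \<kappa> E small_gain_1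
    by (simp_all add: \<delta>_def \<kappa>_def E_def r_def mult_ac)
  obtain c where c: "c > 0"
    and \<Delta>_bound: "\<And>y t B. (\<And>i. \<bar>y (t - dly i)\<bar> \<le> B) \<Longrightarrow> norm (\<Delta> y t) \<le> c * B"
    using Delta_history_bound[OF h0, where 'n='n] unfolding \<Delta>_def r_eq dly_def by metis
  have \<Delta>_add: "\<Delta> (\<lambda>s. y s + z s) t = \<Delta> y t + \<Delta> z t" for y z t
    unfolding \<Delta>_def r_eq by (rule Delta_history_add[OF h0])

  \<comment> \<open>\<open>A\<close> and \<open>C1\<close> bound the right-hand side of the closed
    loop, with \<open>n\<close> coming from the l1 norm. \<open>C2\<close> is the resulting Gronwall
    constant at horizon \<open>r\<close>. The summands of \<open>C3\<close> come from the initial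
    interval, from \<open>v\<close> and from \<open>e\<close>. \<open>\<rho>\<close> is the loop
    gain.\<close>
  define A where "A = real n * (1 + \<beta> * \<kappa> * c)"
  define C1 where "C1 = real n * (1 + \<beta> * \<kappa> * c * E)"
  define C2 where "C2 = 2 * exp (2 * A * r) * (1 + A * r + C1 * r)"
  define L where "L = (\<Sum>j=1..n. K j * h powi (int j + 1 - int n))"
  define C3 where "C3 = E * ((1 + c) * C2) + E * L + \<delta> * c * E"
  define C4 where "C4 = M 0 + (\<Sum>i=1..n. M i) + M n * \<beta> * \<kappa> * (C3 / (1 - \<delta>) + c * E)"
  define \<rho> where "\<rho> = M n * \<beta> * \<kappa> * \<delta> / (1 - \<delta>)"
  define Q where "Q = C4 / (1 - \<rho>)"
  have A: "0 < A"
    unfolding A_def using n_ge_2 \<beta>_pos \<kappa> c by (intro mult_pos_pos add_pos_nonneg) auto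
  have C1: "0 \<le> C1"
    unfolding C1_def using \<beta>_pos \<kappa> c E by simp
  have "1 \<le> exp (2 * A * r) * (1 + A * r + C1 * r)"
    using mult_mono[of 1 "exp (2 * A * r)" 1 "1 + A * r + C1 * r"] A C1 r by simp
  then have C2: "1 \<le> C2"
    unfolding C2_def by simp
  have L: "0 \<le> L"
    unfolding L_def using K_pos h_pos by (intro sum_nonneg mult_nonneg_nonneg) (auto intro: less_imp_le)
  have C3: "0 \<le> C3"
    unfolding C3_def using E c C2 L \<delta> by simp
  have M: "0 \<le> M i" if "i \<le> n" for i
    using M_pos[OF that] by simp
  have C4: "0 < C4"
    unfolding C4_def using M M_pos[of 0] \<beta>_pos \<kappa> C3 \<delta> c E
    by (intro add_pos_nonneg mult_nonneg_nonneg add_nonneg_nonneg sum_nonneg) auto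
  \<comment> \<open>The second smallness condition is the bound \<open>M n * \<beta> * \<kappa> *
    \<delta> / (1 - \<delta>)\<^sup>2 < 1\<close>; since \<open>0 < 1 - \<delta> \<le> 1\<close>, a
    single factor in the denominator gives a smaller value.\<close>
  have "\<rho> \<le> M n * \<beta> * \<kappa> * \<delta> / (1 - \<delta>)\<^sup>2"
    unfolding \<rho>_def using M \<beta>_pos \<kappa> \<delta>
    by (intro divide_left_mono) (auto simp: power2_eq_square mult_left_le)
  also have "\<dots> < 1"
    using small_gain_2 by (simp add: \<delta>_def \<kappa>_def E_def r_def power2_eq_square mult_ac)
  finally have \<rho>: "\<rho> < 1" .
  have Q: "0 < Q"
    unfolding Q_def using C4 \<rho> by simp

  \<comment> \<open>The estimate at a fixed final time\<close>
  have main: "norm (x T) \<le> Q * (exp (- \<mu> * T) * (SUP \<theta>\<in>{- r..0}. norm (x \<theta>))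
      + (\<Sum>i=1..n. ess_sup {0..T} (\<lambda>\<tau>. exp (- \<mu> * (T - \<tau>)) * \<bar>v \<tau> $ idx i\<bar>))
      + ess_sup {- r..T} (\<lambda>\<tau>. exp (- \<mu> * (T - \<tau>)) * \<bar>e \<tau>\<bar>))"
    if v: "v \<in> Linf_loc {0..} UNIV" and e: "e \<in> Linf_loc UNIV UNIV" and d: "d \<in> Linf_loc {0..} D"
      and hist_cont: "continuous_on {- r..0} x"
      and sol: "caratheodory_solution 0 (system_rhs a d v (\<lambda>t. k \<bullet> \<Delta> (\<lambda>s. x s $ idx 1 + e s) t) x) x"
      and T: "0 \<le> T"
    for v e d x T
  proof -
    define \<phi> where "\<phi> \<tau> = exp (- \<mu> * (T - \<tau>))" for \<tau>
    define H where "H = (SUP \<theta>\<in>{- r..0}. norm (x \<theta>))"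
    define V where "V i = ess_sup {0..T} (\<lambda>\<tau>. \<phi> \<tau> * \<bar>v \<tau> $ idx i\<bar>)" for i
    define W where "W = ess_sup {- r..T} (\<lambda>\<tau>. \<phi> \<tau> * \<bar>e \<tau>\<bar>)"
    define G where "G = \<phi> 0 * H + (\<Sum>i=1..n. V i) + W"
    define u where "u t = k \<bullet> \<Delta> (\<lambda>s. x s $ idx 1 + e s) t" for t
    define Y where "Y t = x t - \<Delta> (\<lambda>s. x s $ idx 1) t" for t
    define b where "b t = a (d t, x t)" for t

    \<comment> \<open>The weight and the common bound \<open>G\<close>\<close>
    have \<phi>_pos: "0 < \<phi> \<tau>" for \<tau>
      by (simp add: \<phi>_def)
    then have \<phi>_nonneg: "0 \<le> \<phi> \<tau>" for \<tau>
      by (rule less_imp_le)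
    have \<phi>_mono: "\<phi> \<sigma> \<le> \<phi> \<tau>" if "\<sigma> \<le> \<tau>" for \<sigma> \<tau>
      using that \<mu>_pos by (simp add: \<phi>_def)
    \<comment> \<open>Going back in time by at most \<open>r\<close> costs the factor
      \<open>E\<close>; this is the exponential in the smallness conditions.\<close>
    have \<phi>_delay: "\<phi> \<tau> \<le> E * \<phi> \<sigma>" if "\<tau> - r \<le> \<sigma>" for \<sigma> \<tau>
    proof -
      have "\<mu> * (\<tau> - r) \<le> \<mu> * \<sigma>"
        using that \<mu>_pos by simp
      then show ?thesis
        by (simp add: \<phi>_def E_def exp_add[symmetric] algebra_simps)
    qed
    have hist: "norm (x \<theta>) \<le> H" if "\<theta> \<in> {- r..0}" for \<theta>
    proof -
      have "bdd_above ((\<lambda>\<theta>. norm (x \<theta>)) ` {- r..0})"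
        by (intro bounded_imp_bdd_above compact_imp_bounded compact_continuous_image
            continuous_on_norm hist_cont) simp
      then show ?thesis
        unfolding H_def using that by (rule cSUP_upper2) simp
    qed
    have V0: "0 \<le> V i" for i
      unfolding V_def by (intro ess_sup_nonneg) (simp_all add: \<phi>_nonneg)
    have W0: "0 \<le> W"
      unfolding W_def by (intro ess_sup_nonneg) (simp_all add: \<phi>_nonneg)
    have H0: "0 \<le> H"
      using hist[of 0] r by (auto intro: order_trans[OF norm_ge_zero])
    have "0 \<le> (\<Sum>i=1..n. V i)"
      by (intro sum_nonneg V0)
    then have H_le: "\<phi> 0 * H \<le> G" and W_le: "W \<le> G" and G: "0 \<le> G"
      using W0 H0 \<phi>_pos[of 0] by (auto simp: G_def)
    have V_le: "V i \<le> G" if "i \<in> {1..n}" for i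
      using member_le_sum[of i "{1..n}" V] that V0 W0 H0 \<phi>_pos[of 0] by (simp add: G_def add_increasing add_increasing2)

    \<comment> \<open>Regularity of the signals in the loop\<close>
    have x_cont: "continuous_on {0..} x"
      by (rule caratheodory_solution_continuous_on[OF sol])
    have "{- r..} = {- r..0} \<union> {0..}"
      using r by auto
    then have x_cont': "continuous_on {- r..} x"
      using continuous_on_closed_Un[OF closed_atLeastAtMost closed_atLeast hist_cont x_cont] by simp
    have \<Delta>_cont: "continuous_on {0..} (\<Delta> (\<lambda>s. x s $ idx 1))"
      unfolding \<Delta>_def r_eq using x_cont'[unfolded r_eq]
      by (intro continuous_on_Delta_history[OF h0] continuous_intros)
    then have Y_cont: "continuous_on {0..} Y"
      unfolding Y_def by (intro continuous_intros x_cont)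

    have d_in: "d t \<in> D" if "0 \<le> t" for t
      using d that by (auto simp: Linf_loc_def)
    have b_bound: "\<bar>b t\<bar> \<le> \<beta>" if "0 \<le> t" for t
      using a_bounds[OF d_in[OF that], of "x t"] \<alpha>_pos by (simp add: b_def)
    \<comment> \<open>Along the given trajectory the coefficient is just a bounded measurable
      function of time, so its products with feedback terms are admissible inputs.\<close>
    have b_Linf: "b \<in> Linf_loc {0..} UNIV"
      unfolding b_def using a_bounds \<alpha>_pos
      by (intro Linf_loc_coefficient[OF D_compact locally_lipschitz_on_imp_continuous_on[OF a_lipschitz] _ d x_cont, of \<beta>])
        (smt (verit))
    \<comment> \<open>The first term is the nominal feedback; the bracket collects the effects of
      the measurement error and of the observation error.\<close>
    have u_eq: "u t = k \<bullet> x t + (k \<bullet> \<Delta> e t - k \<bullet> Y t)" for t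
      by (simp add: u_def Y_def \<Delta>_add inner_add_right inner_diff_right)
    have \<Delta>e_Linf: "(\<lambda>t. k \<bullet> \<Delta> e t) \<in> Linf_loc {0..} UNIV"
      unfolding \<Delta>_def r_eq
      by (rule Linf_loc_bounded_linear[OF Linf_loc_Delta_history[OF h0 e] bounded_linear_inner_right])
    have err_Linf: "(\<lambda>t. k \<bullet> \<Delta> e t - k \<bullet> Y t) \<in> Linf_loc {0..} UNIV"
    proof -
      have "(\<lambda>t. - (k \<bullet> Y t)) \<in> Linf_loc {0..} UNIV"
        by (intro Linf_loc_continuous continuous_intros Y_cont) simp
      from Linf_loc_add[OF \<Delta>e_Linf this] show ?thesis
        by simp
    qed
    have u_Linf: "u \<in> Linf_loc {0..} UNIV"
    proof -
      have "(\<lambda>t. k \<bullet> x t) \<in> Linf_loc {0..} UNIV"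
        by (intro Linf_loc_continuous continuous_intros x_cont) simp
      from Linf_loc_add[OF this err_Linf] show ?thesis
        unfolding u_eq[abs_def] .
    qed
    have input_Linf: "(\<lambda>t. v t + (b t * g t) *\<^sub>R axis N 1) \<in> Linf_loc {0..} UNIV"
      if "g \<in> Linf_loc {0..} UNIV" for g
      by (rule Linf_loc_add[OF v Linf_loc_bounded_linear[OF Linf_loc_mult[OF b_Linf that]
            bounded_linear_scaleR_left]])
    \<comment> \<open>The same trajectory is read in two ways. With \<open>p\<close> the whole term
      \<open>a u\<close> is an input of the chain of integrators, as property (i) requires; with
      \<open>q\<close> only the deviation from the nominal feedback is an input.\<close>
    define p where "p t = v t + (b t * u t) *\<^sub>R axis N 1" for t
    define q where "q t = v t + (b t * (k \<bullet> \<Delta> e t - k \<bullet> Y t)) *\<^sub>R axis N 1" for t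
    have p_sol: "caratheodory_solution 0 (chain_rhs p x) x"
    proof -
      have "chain_rhs p x = system_rhs a d v u x"
        by (intro ext vec_eq_iff[THEN iffD2] allI)
          (simp add: chain_rhs_def system_rhs_def p_def b_def axis_def pos_less flip: n_def)
      then show ?thesis
        using sol by (simp add: u_def[abs_def])
    qed
    have q_sol: "caratheodory_solution 0 (system_rhs a d q (\<lambda>s. k \<bullet> x s) x) x"
    proof -
      have "system_rhs a d q (\<lambda>s. k \<bullet> x s) x = system_rhs a d v u x"
        by (intro ext vec_eq_iff[THEN iffD2] allI)
          (simp add: system_rhs_def q_def u_eq b_def axis_def pos_less distrib_left flip: n_def)
      then show ?thesis
        using sol by (simp add: u_def[abs_def])
    qed

    \<comment> \<open>Almost-everywhere bounds on the inputs\<close>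
    have "AE \<tau> in lebesgue. \<tau> \<in> {0..T} \<longrightarrow> \<phi> \<tau> * \<bar>v \<tau> $ i\<bar> \<le> G" for i
    proof -
      have "(\<lambda>t. v t $ i) \<in> Linf_loc {0..} UNIV"
        by (rule Linf_loc_bounded_linear[OF v bounded_linear_vec_nth])
      then have "AE \<tau> in lebesgue. \<tau> \<in> {0..T} \<longrightarrow> \<phi> \<tau> * \<bar>v \<tau> $ i\<bar> \<le> V (pos i)"
        unfolding V_def idx_pos \<phi>_def
        by (rule AE_weighted_le_ess_sup) (auto intro!: continuous_intros)
      moreover have "V (pos i) \<le> G"
        using range_pos[where 'n='n] by (intro V_le) (auto simp: n_def)
      ultimately show ?thesis
        by (auto elim!: eventually_mono)
    qed
    then have AE_v: "AE \<tau> in lebesgue. \<forall>i. \<tau> \<in> {0..T} \<longrightarrow> \<phi> \<tau> * \<bar>v \<tau> $ i\<bar> \<le> G"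
      by (intro eventually_all_finite)
    have "AE \<tau> in lebesgue. \<tau> \<in> {0..T} \<longrightarrow> \<phi> \<tau> * \<bar>e (\<tau> - dly i)\<bar> \<le> E * G" for i
    proof -
      have "AE \<tau> in lebesgue. \<tau> \<in> {- r..T} \<longrightarrow> \<phi> \<tau> * \<bar>e \<tau>\<bar> \<le> W"
        unfolding W_def \<phi>_def
        by (rule AE_weighted_le_ess_sup[OF e]) (auto intro!: continuous_intros)
      from AE_lebesgue_shift[OF this, of "dly i"] show ?thesis
      proof (rule eventually_mono, intro impI)
        fix \<tau> assume *: "\<tau> - dly i \<in> {- r..T} \<longrightarrow> \<phi> (\<tau> - dly i) * \<bar>e (\<tau> - dly i)\<bar> \<le> W"
          and \<tau>: "\<tau> \<in> {0..T}"
        have "\<phi> \<tau> * \<bar>e (\<tau> - dly i)\<bar> \<le> E * \<phi> (\<tau> - dly i) * \<bar>e (\<tau> - dly i)\<bar>"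
          using dly[of i] by (intro mult_right_mono \<phi>_delay) auto
        also have "\<dots> = E * (\<phi> (\<tau> - dly i) * \<bar>e (\<tau> - dly i)\<bar>)"
          by simp
        also have "\<dots> \<le> E * G"
          using * \<tau> dly[of i] E W_le by (intro mult_left_mono) auto
        finally show "\<phi> \<tau> * \<bar>e (\<tau> - dly i)\<bar> \<le> E * G" .
      qed
    qed
    then have AE_e: "AE \<tau> in lebesgue. \<forall>i. \<tau> \<in> {0..T} \<longrightarrow> \<phi> \<tau> * \<bar>e (\<tau> - dly i)\<bar> \<le> E * G"
      by (intro eventually_all_finite)
    \<comment> \<open>All later pointwise estimates are made off this one null set. The finitely
      many samples of \<open>e\<close> are bounded simultaneously there, hence so is
      \<open>\<Delta> e\<close>.\<close>
    have good: "AE \<tau> in lebesgue. \<tau> \<in> {0..T} \<longrightarrow>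
      (\<forall>i. \<phi> \<tau> * \<bar>v \<tau> $ i\<bar> \<le> G) \<and> \<phi> \<tau> * norm (\<Delta> e \<tau>) \<le> c * E * G"
      using AE_v AE_e
    proof eventually_elim
      case (elim \<tau>)
      have "\<phi> \<tau> * norm (\<Delta> e \<tau>) \<le> c * E * G" if "\<tau> \<in> {0..T}"
      proof -
        have "\<bar>e (\<tau> - dly i)\<bar> \<le> E * G / \<phi> \<tau>" for i
          using elim(2) that \<phi>_pos[of \<tau>] by (simp add: pos_le_divide_eq mult.commute)
        from \<Delta>_bound[of e \<tau>, OF this] show ?thesis
          using \<phi>_pos[of \<tau>] by (simp add: pos_le_divide_eq mult_ac)
      qed
      with elim(1) show ?case by blast
    qed

    \<comment> \<open>The initial interval\<close>
    have H_le': "H \<le> G / \<phi> 0"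
      using H_le \<phi>_pos[of 0] by (simp add: pos_le_divide_eq mult.commute)
    have early: "norm (x s) \<le> C2 * (G / \<phi> 0)" if s: "s \<in> {- r..r}" "s \<le> T" for s
    proof (cases "s \<le> 0")
      case True
      then have "norm (x s) \<le> G / \<phi> 0"
        using hist[of s] s H_le' by simp
      also have "\<dots> \<le> C2 * (G / \<phi> 0)"
        using mult_right_mono[OF C2, of "G / \<phi> 0"] G \<phi>_nonneg[of 0] by simp
      finally show ?thesis .
    next
      case False
      define G0 where "G0 = G / \<phi> 0"
      have G0: "0 \<le> G0"
        using G \<phi>_pos[of 0] by (simp add: G0_def)
      \<comment> \<open>At nonnegative times the weight is at least \<open>\<phi> 0\<close>, so
        weighted bounds become uniform ones.\<close>
      have G0_le: "z \<le> g * G0" if "0 \<le> \<tau>" "0 \<le> z" "\<phi> \<tau> * z \<le> g * G" for z g \<tau>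
      proof -
        have "\<phi> 0 * z \<le> \<phi> \<tau> * z"
          using that by (intro mult_right_mono \<phi>_mono)
        then show ?thesis
          using that \<phi>_pos[of 0] by (simp add: G0_def pos_le_divide_eq mult.commute)
      qed
      \<comment> \<open>The Gronwall horizon is \<open>s\<close> rather than \<open>r\<close>,
        because the bounds on the inputs reach only up to \<open>T\<close>, which may be less than
        \<open>r\<close>. Monotonicity then replaces \<open>s\<close> by \<open>r\<close> in the
        constants.\<close>
      have "norm (x s) \<le> 2 * exp (2 * A * s) * (G0 * (1 + A * s) + (C1 * G0) * s)"
      proof (rule delay_gronwall[OF sol[folded u_def] A _ _ r])
        show "0 \<le> C1 * G0"
          using C1 G0 by simp
        show "norm (x \<sigma>) \<le> G0" if "\<sigma> \<in> {- r..0}" for \<sigma>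
          using hist[OF that] H_le' by (simp add: G0_def)
        show "AE \<tau> in lebesgue. \<tau> \<in> {0..s} \<longrightarrow>
          (\<forall>Z. (\<forall>\<sigma>\<in>{- r..\<tau>}. norm (x \<sigma>) \<le> Z) \<longrightarrow>
            norm (system_rhs a d v u x \<tau>) \<le> A * Z + C1 * G0)"
          using good
        proof (eventually_elim, intro impI allI)
          fix \<tau> Z
          assume *: "\<tau> \<in> {0..T} \<longrightarrow> (\<forall>i. \<phi> \<tau> * \<bar>v \<tau> $ i\<bar> \<le> G) \<and> \<phi> \<tau> * norm (\<Delta> e \<tau>) \<le> c * E * G"
            and \<tau>: "\<tau> \<in> {0..s}" and Z: "\<forall>\<sigma>\<in>{- r..\<tau>}. norm (x \<sigma>) \<le> Z"
          have v_le: "\<bar>v \<tau> $ i\<bar> \<le> G0" for i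
            using G0_le[of \<tau> _ 1] * \<tau> s by simp
          have "norm (\<Delta> e \<tau>) \<le> c * E * G0"
            using G0_le[of \<tau>] * \<tau> s by simp
          moreover have "norm (\<Delta> (\<lambda>s. x s $ idx 1) \<tau>) \<le> c * Z"
          proof (rule \<Delta>_bound)
            fix i
            have "norm (x (\<tau> - dly i)) \<le> Z"
              using Z \<tau> dly[of i] by simp
            then show "\<bar>x (\<tau> - dly i) $ idx 1\<bar> \<le> Z"
              using component_le_norm_cart order_trans by blast
          qed
          moreover have "norm (\<Delta> (\<lambda>s. x s $ idx 1 + e s) \<tau>) \<le> norm (\<Delta> (\<lambda>s. x s $ idx 1) \<tau>) + norm (\<Delta> e \<tau>)"
            unfolding \<Delta>_add by (rule norm_triangle_ineq)
          ultimately have "norm (\<Delta> (\<lambda>s. x s $ idx 1 + e s) \<tau>) \<le> c * Z + c * E * G0"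
            by simp
          then have "\<bar>u \<tau>\<bar> \<le> \<kappa> * (c * Z + c * E * G0)"
            unfolding u_def \<kappa>_def using Cauchy_Schwarz_ineq2 mult_left_mono norm_ge_zero order_trans by metis
          then have bu: "\<bar>b \<tau> * u \<tau>\<bar> \<le> \<beta> * (\<kappa> * (c * Z + c * E * G0))"
            unfolding abs_mult using b_bound[of \<tau>] \<tau> \<beta>_pos by (intro mult_mono) auto
          have "norm (x \<tau>) \<le> Z"
            using Z \<tau> r by simp
          then have x_le: "\<bar>x \<tau> $ i\<bar> \<le> Z" and Z0: "0 \<le> Z" for i
            using component_le_norm_cart[of "x \<tau>" i] norm_ge_zero[of "x \<tau>"] by linarith+
          have comp: "\<bar>system_rhs a d v u x \<tau> $ i\<bar> \<le> Z + G0 + \<beta> * (\<kappa> * (c * Z + c * E * G0))" for i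
          proof (cases "pos i < CARD('n)")
            case True
            then have "system_rhs a d v u x \<tau> $ i = x \<tau> $ idx (pos i + 1) + v \<tau> $ i"
              by (simp add: system_rhs_def)
            then show ?thesis
              using v_le[of i] x_le[of "idx (pos i + 1)"] bu by linarith
          next
            case False
            then have "system_rhs a d v u x \<tau> $ i = v \<tau> $ i + b \<tau> * u \<tau>"
              by (simp add: system_rhs_def b_def)
            then show ?thesis
              using v_le[of i] Z0 bu by linarith
          qed
          have "norm (system_rhs a d v u x \<tau>) \<le> (\<Sum>i\<in>UNIV. \<bar>system_rhs a d v u x \<tau> $ i\<bar>)"
            by (rule norm_le_l1_cart)
          also have "\<dots> \<le> of_nat (card (UNIV :: 'n set)) * (Z + G0 + \<beta> * (\<kappa> * (c * Z + c * E * G0)))"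
            by (rule sum_bounded_above) (rule comp)
          also have "\<dots> = A * Z + C1 * G0"
            by (simp add: A_def C1_def n_def algebra_simps)
          finally show "norm (system_rhs a d v u x \<tau>) \<le> A * Z + C1 * G0" .
        qed
      qed (use False in auto)
      also have "\<dots> \<le> 2 * exp (2 * A * r) * (G0 * (1 + A * r) + (C1 * G0) * r)"
        using s False A C1 G0 by (intro mult_mono add_mono mult_left_mono) auto
      also have "\<dots> = C2 * G0"
        by (simp add: C2_def algebra_simps)
      finally show ?thesis
        by (simp add: G0_def)
    qed

    \<comment> \<open>The observation error\<close>
    have Y_step: "\<phi> s * norm (Y s) \<le> (C3 * G + \<delta> * X) + \<delta> * B"
      if X: "\<And>s. s \<in> {0..T} \<Longrightarrow> \<phi> s * norm (x s) \<le> X"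
        and B: "\<And>s. s \<in> {0..T} \<Longrightarrow> \<phi> s * norm (Y s) \<le> B"
        and s: "s \<in> {0..T}" for X B s
    proof -
      \<comment> \<open>\<open>X\<close> and \<open>B\<close> are arbitrary bounds on the weighted
        state and error. Each returns with the factor \<open>\<delta>\<close>, since
        \<open>u\<close> depends on \<open>x\<close> and \<open>Y\<close> through
        \<open>k \<bullet> (x - Y)\<close>.\<close>
      have X0: "0 \<le> X" and B0: "0 \<le> B"
        using X[OF s] B[OF s] \<phi>_nonneg[of s] by (meson mult_nonneg_nonneg norm_ge_zero order_trans)+
      have nn: "0 \<le> E * ((1 + c) * C2) * G" "0 \<le> E * L * G" "0 \<le> \<delta> * c * E * G" "0 \<le> \<delta> * X" "0 \<le> \<delta> * B"
        using E c C2 L \<delta> G X0 B0 by simp_all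
      have C3_G: "C3 * G = E * ((1 + c) * C2) * G + E * L * G + \<delta> * c * E * G"
        by (simp add: C3_def algebra_simps)
      show ?thesis
      proof (cases "s \<le> r")
        \<comment> \<open>Property (i) is used only beyond \<open>r\<close>, so here both terms of
          \<open>Y s\<close> are bounded separately by \<open>early\<close>. The weight at
          \<open>s\<close> exceeds the one at 0 by at most the factor \<open>E\<close>.\<close>
        case True
        define g where "g = C2 * (G / \<phi> 0)"
        have "norm (\<Delta> (\<lambda>s. x s $ idx 1) s) \<le> c * g"
        proof (rule \<Delta>_bound)
          fix i
          have "norm (x (s - dly i)) \<le> g"
            unfolding g_def using True s dly[of i] by (intro early) auto
          then show "\<bar>x (s - dly i) $ idx 1\<bar> \<le> g"
            using component_le_norm_cart order_trans by blast
        qed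
        moreover have "norm (x s) \<le> g"
          unfolding g_def using True s r by (intro early) auto
        ultimately have "norm (Y s) \<le> (1 + c) * g"
          unfolding Y_def distrib_right mult_1
          using norm_triangle_ineq4[of "x s" "\<Delta> (\<lambda>s. x s $ idx 1) s"] by linarith
        then have "\<phi> s * norm (Y s) \<le> (E * \<phi> 0) * ((1 + c) * g)"
          using True E \<phi>_nonneg by (intro mult_mono \<phi>_delay mult_nonneg_nonneg) auto
        also have "\<dots> = E * ((1 + c) * C2) * G"
          using \<phi>_pos[of 0] by (simp add: g_def)
        finally show ?thesis
          using nn C3_G by linarith
      next
        case False
        \<comment> \<open>\<open>R j\<close> bounds the weighted \<open>j\<close>-th component of
          \<open>p\<close>; the feedback enters only the last one.\<close>
        define R where "R j = G + (if j = n then \<beta> * \<kappa> * (X + B + c * E * G) else 0)" for j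
        have R0: "0 \<le> R j" for j
          unfolding R_def using G \<beta>_pos \<kappa> X0 B0 c E by simp
        have sup: "ess_sup {s - r..s} (\<lambda>\<tau>. \<bar>p \<tau> $ idx j\<bar>) \<le> E * R j / \<phi> s" if j: "j \<in> {1..n}" for j
        proof (rule ess_sup_le)
          show "AE \<tau> in lebesgue. \<tau> \<in> {s - r..s} \<longrightarrow> \<bar>p \<tau> $ idx j\<bar> \<le> E * R j / \<phi> s"
            using good
          proof (eventually_elim, intro impI)
            fix \<tau>
            assume *: "\<tau> \<in> {0..T} \<longrightarrow> (\<forall>i. \<phi> \<tau> * \<bar>v \<tau> $ i\<bar> \<le> G) \<and> \<phi> \<tau> * norm (\<Delta> e \<tau>) \<le> c * E * G"
              and \<tau>: "\<tau> \<in> {s - r..s}"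
            have \<tau>': "\<tau> \<in> {0..T}"
              using \<tau> False s by simp
            have u_le: "\<phi> \<tau> * \<bar>u \<tau>\<bar> \<le> \<kappa> * (X + B + c * E * G)"
            proof -
              have "u \<tau> = k \<bullet> (x \<tau> + \<Delta> e \<tau> - Y \<tau>)"
                by (simp add: u_eq inner_add_right inner_diff_right)
              then have "\<bar>u \<tau>\<bar> \<le> \<kappa> * norm (x \<tau> + \<Delta> e \<tau> - Y \<tau>)"
                unfolding \<kappa>_def using Cauchy_Schwarz_ineq2 by metis
              also have "\<dots> \<le> \<kappa> * (norm (x \<tau>) + norm (Y \<tau>) + norm (\<Delta> e \<tau>))"
                using \<kappa> norm_triangle_ineq4[of "x \<tau> + \<Delta> e \<tau>" "Y \<tau>"] norm_triangle_ineq[of "x \<tau>" "\<Delta> e \<tau>"]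
                by (intro mult_left_mono) auto
              finally have "\<phi> \<tau> * \<bar>u \<tau>\<bar> \<le> \<phi> \<tau> * (\<kappa> * (norm (x \<tau>) + norm (Y \<tau>) + norm (\<Delta> e \<tau>)))"
                using \<phi>_nonneg by (intro mult_left_mono) auto
              also have "\<dots> = \<kappa> * (\<phi> \<tau> * norm (x \<tau>) + \<phi> \<tau> * norm (Y \<tau>) + \<phi> \<tau> * norm (\<Delta> e \<tau>))"
                by (simp add: algebra_simps)
              also have "\<dots> \<le> \<kappa> * (X + B + c * E * G)"
                using * \<tau>' X[OF \<tau>'] B[OF \<tau>'] \<kappa> by (intro mult_left_mono add_mono) auto
              finally show ?thesis .
            qed
            have "\<bar>b \<tau>\<bar> * (\<phi> \<tau> * \<bar>u \<tau>\<bar>) \<le> \<beta> * (\<kappa> * (X + B + c * E * G))"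
              using mult_mono[OF b_bound[of \<tau>] u_le] \<tau>' \<beta>_pos \<phi>_nonneg[of \<tau>] by simp
            then have bu: "\<phi> \<tau> * \<bar>b \<tau> * u \<tau>\<bar> \<le> \<beta> * \<kappa> * (X + B + c * E * G)"
              by (simp add: abs_mult mult_ac)
            have "\<phi> \<tau> * \<bar>p \<tau> $ idx j\<bar> \<le> R j"
            proof (cases "j = n")
              case True
              have "\<phi> \<tau> * \<bar>p \<tau> $ idx j\<bar> \<le> \<phi> \<tau> * (\<bar>v \<tau> $ idx j\<bar> + \<bar>b \<tau> * u \<tau>\<bar>)"
                using \<phi>_pos[of \<tau>] idx_N[OF j] True by (intro mult_left_mono) (auto simp: p_def axis_def)
              also have "\<dots> \<le> R j"
                using * \<tau>' bu True by (simp add: R_def distrib_left add_mono)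
              finally show ?thesis .
            next
              case False
              then show ?thesis
                using * \<tau>' idx_N[OF j] by (simp add: R_def p_def axis_def)
            qed
            then have "\<bar>p \<tau> $ idx j\<bar> * (E * \<phi> \<tau>) \<le> E * R j"
              using mult_left_mono[of _ "R j" E] E by (simp add: mult_ac)
            moreover have "\<bar>p \<tau> $ idx j\<bar> * \<phi> s \<le> \<bar>p \<tau> $ idx j\<bar> * (E * \<phi> \<tau>)"
              using \<tau> by (intro mult_left_mono \<phi>_delay) auto
            ultimately show "\<bar>p \<tau> $ idx j\<bar> \<le> E * R j / \<phi> s"
              using \<phi>_pos[of s] by (simp add: pos_le_divide_eq)
          qed
          show "0 \<le> E * R j / \<phi> s"
            using E R0 \<phi>_pos[of s] by simp
        qed simp
        have "norm (Y s) \<le> (\<Sum>j=1..n. K j * h powi (int j + 1 - int n)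
            * ess_sup {s - r..s} (\<lambda>\<tau>. \<bar>p \<tau> $ idx j\<bar>))"
          unfolding Y_def \<Delta>_def r_def
        proof (rule property_i[OF h_pos h_le_1 _ _ p_sol refl])
          show "(\<lambda>s. p s $ i) \<in> Linf_loc {0..} UNIV" for i
            unfolding p_def by (rule Linf_loc_bounded_linear[OF input_Linf[OF u_Linf] bounded_linear_vec_nth])
          show "0 + real (n - 1) * h \<le> s"
            using False by (simp add: r_def)
        qed simp
        also have "\<dots> \<le> (\<Sum>j=1..n. K j * h powi (int j + 1 - int n) * (E * R j / \<phi> s))"
          using K_pos h_pos by (intro sum_mono mult_left_mono sup mult_nonneg_nonneg) (auto intro: less_imp_le)
        also have "\<dots> = (E / \<phi> s) * (\<Sum>j=1..n. K j * h powi (int j + 1 - int n) * R j)"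
          by (simp add: sum_distrib_left mult_ac)
        \<comment> \<open>For \<open>j = n\<close> the exponent of \<open>h\<close> is 1. This
          factor \<open>h\<close>, together with \<open>K n\<close>, \<beta>, \<kappa> and
          \<open>E\<close>, makes up \<open>\<delta>\<close>.\<close>
        also have "(\<Sum>j=1..n. K j * h powi (int j + 1 - int n) * R j)
            = L * G + K n * h * (\<beta> * \<kappa> * (X + B + c * E * G))"
        proof -
          have "(\<Sum>j=1..n. K j * h powi (int j + 1 - int n) * R j)
            = L * G + (\<Sum>j=1..n. if j = n then K j * h powi (int j + 1 - int n) * (\<beta> * \<kappa> * (X + B + c * E * G)) else 0)"
            unfolding L_def sum_distrib_right sum.distrib[symmetric]
            by (intro sum.cong) (auto simp: R_def distrib_left)
          then show ?thesis
            using n_ge_2 by simp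
        qed
        finally have "\<phi> s * norm (Y s) \<le> E * (L * G + K n * h * (\<beta> * \<kappa> * (X + B + c * E * G)))"
          using \<phi>_pos[of s] by (simp add: pos_le_divide_eq mult_ac)
        also have "\<dots> = E * L * G + \<delta> * c * E * G + \<delta> * X + \<delta> * B"
          by (simp add: \<delta>_def algebra_simps)
        finally show ?thesis
          using nn C3_G by linarith
      qed
    qed

    \<comment> \<open>The state estimate and the closing of the loop\<close>
    have bounded: "\<exists>b. \<forall>s\<in>{0..T}. \<phi> s * norm (z s) \<le> b" if "continuous_on {0..} z" for z :: "real \<Rightarrow> real^'n::_"
    proof -
      have "continuous_on {0..T} z"
        using that by (rule continuous_on_subset) auto
      then have "bounded ((\<lambda>s. \<phi> s * norm (z s)) ` {0..T})"
        unfolding \<phi>_def by (intro compact_imp_bounded compact_continuous_image continuous_intros) auto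
      then show ?thesis
        by (auto simp: bdd_above_def dest!: bounded_imp_bdd_above)
    qed
    \<comment> \<open>With the bound \<open>X\<close> on the state fixed, the inner loop through
      \<open>Y\<close> is closed by \<open>\<delta> < 1\<close>.\<close>
    have Y_bound: "\<phi> s * norm (Y s) \<le> (C3 * G + \<delta> * X) / (1 - \<delta>)"
      if X: "\<And>s. s \<in> {0..T} \<Longrightarrow> \<phi> s * norm (x s) \<le> X" and s: "s \<in> {0..T}" for X s
    proof -
      obtain b where "\<And>s. s \<in> {0..T} \<Longrightarrow> \<phi> s * norm (Y s) \<le> b"
        using bounded[OF Y_cont] by blast
      then show ?thesis
        using s \<phi>_nonneg
        by (intro small_gain[where f="\<lambda>s. \<phi> s * norm (Y s)" and S="{0..T}" and s=s and b=b] Y_step[OF X] \<delta>) auto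
    qed
    \<comment> \<open>The nominal estimate is applied with input \<open>q\<close>. Inserting the
      error bound from \<open>Y_bound\<close> brings \<open>X\<close> back with the coefficient
      \<open>\<rho>\<close>.\<close>
    have x_step: "\<phi> s * norm (x s) \<le> C4 * G + \<rho> * X"
      if X: "\<And>s. s \<in> {0..T} \<Longrightarrow> \<phi> s * norm (x s) \<le> X" and s: "s \<in> {0..T}" for X s
    proof -
      define B where "B = (C3 * G + \<delta> * X) / (1 - \<delta>)"
      define R where "R j = G + (if j = n then \<beta> * \<kappa> * (B + c * E * G) else 0)" for j
      have B: "\<phi> s * norm (Y s) \<le> B" if "s \<in> {0..T}" for s
        unfolding B_def by (rule Y_bound[OF X that])
      have B0: "0 \<le> B"
        using B[OF s] \<phi>_nonneg[of s] by (meson mult_nonneg_nonneg norm_ge_zero order_trans)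
      have R0: "0 \<le> R j" for j
        unfolding R_def using G \<beta>_pos \<kappa> B0 c E by simp
      \<comment> \<open>The nominal estimate weighs relative to \<open>s\<close>; this identity
        converts it to the weight relative to \<open>T\<close>.\<close>
      have \<phi>_split: "\<phi> \<tau> = \<phi> s * exp (- \<mu> * (s - \<tau>))" for \<tau>
        by (simp add: \<phi>_def exp_add[symmetric] algebra_simps)
      have sup: "ess_sup {0..s} (\<lambda>\<tau>. exp (- \<mu> * (s - \<tau>)) * \<bar>q \<tau> $ idx j\<bar>) \<le> R j / \<phi> s" if j: "j \<in> {1..n}" for j
      proof (rule ess_sup_le)
        show "AE \<tau> in lebesgue. \<tau> \<in> {0..s} \<longrightarrow> exp (- \<mu> * (s - \<tau>)) * \<bar>q \<tau> $ idx j\<bar> \<le> R j / \<phi> s"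
          using good
        proof (eventually_elim, intro impI)
          fix \<tau>
          assume *: "\<tau> \<in> {0..T} \<longrightarrow> (\<forall>i. \<phi> \<tau> * \<bar>v \<tau> $ i\<bar> \<le> G) \<and> \<phi> \<tau> * norm (\<Delta> e \<tau>) \<le> c * E * G"
            and \<tau>: "\<tau> \<in> {0..s}"
          have \<tau>': "\<tau> \<in> {0..T}"
            using \<tau> s by simp
          define w where "w = k \<bullet> \<Delta> e \<tau> - k \<bullet> Y \<tau>"
          have w_le: "\<phi> \<tau> * \<bar>w\<bar> \<le> \<kappa> * (B + c * E * G)"
          proof -
            have "\<bar>w\<bar> \<le> \<kappa> * norm (\<Delta> e \<tau> - Y \<tau>)"
              unfolding \<kappa>_def w_def inner_diff_right[symmetric] by (rule Cauchy_Schwarz_ineq2)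
            also have "\<dots> \<le> \<kappa> * (norm (Y \<tau>) + norm (\<Delta> e \<tau>))"
              using \<kappa> norm_triangle_ineq4[of "\<Delta> e \<tau>" "Y \<tau>"] by (intro mult_left_mono) auto
            finally have "\<phi> \<tau> * \<bar>w\<bar> \<le> \<phi> \<tau> * (\<kappa> * (norm (Y \<tau>) + norm (\<Delta> e \<tau>)))"
              using \<phi>_nonneg by (intro mult_left_mono) auto
            also have "\<dots> = \<kappa> * (\<phi> \<tau> * norm (Y \<tau>) + \<phi> \<tau> * norm (\<Delta> e \<tau>))"
              by (simp add: algebra_simps)
            also have "\<dots> \<le> \<kappa> * (B + c * E * G)"
              using * \<tau>' B[OF \<tau>'] \<kappa> by (intro mult_left_mono add_mono) auto
            finally show ?thesis .
          qed
          have "\<bar>b \<tau>\<bar> * (\<phi> \<tau> * \<bar>w\<bar>) \<le> \<beta> * (\<kappa> * (B + c * E * G))"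
            using mult_mono[OF b_bound[of \<tau>] w_le] \<tau>' \<beta>_pos \<phi>_nonneg[of \<tau>] by simp
          then have bw: "\<phi> \<tau> * \<bar>b \<tau> * w\<bar> \<le> \<beta> * \<kappa> * (B + c * E * G)"
            by (simp add: abs_mult mult_ac)
          have "\<phi> \<tau> * \<bar>q \<tau> $ idx j\<bar> \<le> R j"
          proof (cases "j = n")
            case True
            have "\<phi> \<tau> * \<bar>q \<tau> $ idx j\<bar> \<le> \<phi> \<tau> * (\<bar>v \<tau> $ idx j\<bar> + \<bar>b \<tau> * w\<bar>)"
              using \<phi>_pos[of \<tau>] idx_N[OF j] True by (intro mult_left_mono) (auto simp: q_def axis_def w_def)
            also have "\<dots> \<le> R j"
              using * \<tau>' bw True by (simp add: R_def distrib_left add_mono)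
            finally show ?thesis .
          next
            case False
            then show ?thesis
              using * \<tau>' idx_N[OF j] by (simp add: R_def q_def axis_def)
          qed
          then show "exp (- \<mu> * (s - \<tau>)) * \<bar>q \<tau> $ idx j\<bar> \<le> R j / \<phi> s"
            using \<phi>_pos[of s] unfolding \<phi>_split[of \<tau>] by (simp add: pos_le_divide_eq mult_ac)
        qed
        show "0 \<le> R j / \<phi> s"
          using R0 \<phi>_pos[of s] by simp
      qed simp
      have "norm (x s) \<le> M 0 * exp (- \<mu> * (s - 0)) * norm (x 0)
          + (\<Sum>i=1..n. M i * ess_sup {0..s} (\<lambda>\<tau>. exp (- \<mu> * (s - \<tau>)) * \<bar>q \<tau> $ idx i\<bar>))"
        by (rule nominal_estimate[OF _ d _ q_sol refl])
          (use s input_Linf[OF err_Linf] in \<open>auto simp: q_def[abs_def]\<close>)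
      also have "\<dots> \<le> M 0 * exp (- \<mu> * (s - 0)) * norm (x 0) + (\<Sum>i=1..n. M i * (R i / \<phi> s))"
        using M by (intro add_left_mono sum_mono mult_left_mono sup) auto
      also have "(\<Sum>i=1..n. M i * (R i / \<phi> s)) = ((\<Sum>i=1..n. M i) * G + M n * (\<beta> * \<kappa> * (B + c * E * G))) / \<phi> s"
      proof -
        have "(\<Sum>i=1..n. M i * (R i / \<phi> s)) = (\<Sum>i=1..n. M i * R i) / \<phi> s"
          by (simp add: sum_divide_distrib)
        also have "(\<Sum>i=1..n. M i * R i)
          = (\<Sum>i=1..n. M i) * G + (\<Sum>i=1..n. if i = n then M i * (\<beta> * \<kappa> * (B + c * E * G)) else 0)"
          unfolding sum_distrib_right sum.distrib[symmetric]
          by (intro sum.cong) (auto simp: R_def distrib_left)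
        finally show ?thesis
          using n_ge_2 by simp
      qed
      finally have "\<phi> s * norm (x s) \<le> \<phi> s * (M 0 * exp (- \<mu> * (s - 0)) * norm (x 0)
          + ((\<Sum>i=1..n. M i) * G + M n * (\<beta> * \<kappa> * (B + c * E * G))) / \<phi> s)"
        using \<phi>_pos[of s] by (intro mult_left_mono) auto
      also have "\<dots> = M 0 * (\<phi> 0 * norm (x 0)) + (\<Sum>i=1..n. M i) * G + M n * (\<beta> * \<kappa> * (B + c * E * G))"
        unfolding \<phi>_split[of 0] using \<phi>_pos[of s] by (simp add: field_simps)
      also have "\<dots> \<le> M 0 * G + (\<Sum>i=1..n. M i) * G + M n * (\<beta> * \<kappa> * (B + c * E * G))"
      proof -
        have "\<phi> 0 * norm (x 0) \<le> \<phi> 0 * H"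
          using hist[of 0] r \<phi>_pos[of 0] by (intro mult_left_mono) auto
        then show ?thesis
          using M[of 0] H_le by (intro add_right_mono mult_left_mono) auto
      qed
      also have "\<dots> = C4 * G + \<rho> * X"
        using \<delta> by (simp add: C4_def \<rho>_def B_def add_divide_distrib algebra_simps)
      finally show ?thesis .
    qed
    obtain b where "\<And>s. s \<in> {0..T} \<Longrightarrow> \<phi> s * norm (x s) \<le> b"
      using bounded[OF x_cont] by blast
    \<comment> \<open>The outer loop is closed by \<open>\<rho> < 1\<close>. Taking
      \<open>s = T\<close>, where the weight equals 1, gives the unweighted bound.\<close>
    then have "\<phi> T * norm (x T) \<le> C4 * G / (1 - \<rho>)"
      using T \<phi>_nonneg
      by (intro small_gain[where f="\<lambda>s. \<phi> s * norm (x s)" and S="{0..T}" and s=T and b=b] x_step \<rho>) auto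
    then show ?thesis
      by (simp add: Q_def G_def H_def V_def W_def \<phi>_def)
  qed

  \<comment> \<open>From the weighted estimate to the claim\<close>
  show ?thesis
  \<comment> \<open>All terms of \<open>G\<close> share the factor \<open>Q\<close>, so this one
    constant serves as every \<open>Q i\<close> and as \<open>Qe\<close>.\<close>
  proof (intro exI[of _ "\<lambda>_. Q"] exI[of _ Q] conjI allI impI)
    fix v e d x0 x t
    assume v: "v \<in> Linf_loc {0..} UNIV" and e: "e \<in> Linf_loc UNIV UNIV" and d: "d \<in> Linf_loc {0..} D"
      and x0: "continuous_on {- (real (n - 1) * h)..0} x0"
      and sol: "caratheodory_solution 0
          (system_rhs a d v
             (\<lambda>t. k \<bullet> Delta h (history (real (n - 1) * h) t (\<lambda>s. x s $ idx 1 + e s))) x) x"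
      and init: "\<forall>\<theta>\<in>{- (real (n - 1) * h)..0}. x \<theta> = x0 \<theta>" and t: "(0::real) \<le> t"
    have "continuous_on {- r..0} x"
      using x0 init unfolding r_def by (metis continuous_on_cong)
    from main[OF v e d this sol[folded r_def \<Delta>_def] t]
    show "norm (x t)
          \<le> Q * exp (- \<mu> * t) * (SUP \<theta>\<in>{- (real (n - 1) * h)..0}. norm (x \<theta>))
            + (\<Sum>i=1..n. Q * ess_sup {0..t} (\<lambda>\<tau>. exp (- \<mu> * (t - \<tau>)) * \<bar>v \<tau> $ idx i\<bar>))
            + Q * ess_sup {- (real (n - 1) * h)..t} (\<lambda>\<tau>. exp (- \<mu> * (t - \<tau>)) * \<bar>e \<tau>\<bar>)"
      by (simp add: r_def distrib_left sum_distrib_left)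
  qed (use Q in auto)
qed

end
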